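(* Let $n\ge 3$, $k\ge 4$ and $s\ge 2$ be integers, and let $G$ be a 2-connected simple graph on $n$ vertices. If $G$ has an edge $uv$ such that $G$ has no cycle of length at least $k$ containing $uv$, then the number $N_s(G)$ of $s$-cliques of $G$ satisfies \[N_s(G)\le g_s(n,k).\]
   Context: All graphs are finite and simple. $N_s(G)$ denotes the total number of $s$-cliques of $G$, i.e. of complete subgraphs of $G$ with exactly $s$ vertices (so $N_2(G)$ is the number of edges). The binomial coefficient $\binom{m}{j}$ is $0$ when $0\le m<j$. For integers $n\ge 3$, $k\ge 4$, $s\ge 2$, write $n-2=r(k-3)+t$ with integers $r\ge 0$ and $0\le t\le k-4$ (division with remainder), and define \[g_s(n,k)=\begin{cases} r\binom{k-1}{s}+\binom{t+2}{s} & \text{if } s\ge 3,\\[4pt] r\binom{k-3}{2}+\binom{t}{2}+2(n-2)+1 & \text{if } s=2.\end{cases}\] *)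

theory Defs
  imports "Graph_Theory.Graph_Theory"
begin

text \<open>
  A finite simple graph is a \<^locale>\<open>pair_graph\<close>: a finite, symmetric, loop-free digraph whose arcs
  are pairs of vertices, so that an undirected edge \<open>uv\<close> is the pair of arcs \<open>(u, v)\<close>, \<open>(v, u)\<close>.
  For such a graph \<^const>\<open>pre_digraph.cycle\<close> also admits the closed walk \<open>u, v, u\<close> of length 2;
  all its members of length at least 3 are the cycles of the undirected graph, each with a
  choice of starting point and direction.
\<close>

definition k_connected :: "nat \<Rightarrow> ('a, 'b) pre_digraph \<Rightarrow> bool" where
  "k_connected k G \<longleftrightarrow> card (verts G) > k \<and>
     (\<forall>X \<subseteq> verts G. finite X \<and> card X < k \<longrightarrow> connected (G \<restriction> (verts G - X)))"

text \<open>Subgraphs inherit the incidence functions of \<open>G\<close>, so each clique is counted once.\<close>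

definition num_cliques :: "nat \<Rightarrow> ('a, 'b) pre_digraph \<Rightarrow> nat" where
  "num_cliques s G = card {H. subgraph H G \<and> complete_digraph s H}"

text \<open>Intended for \<open>n \<ge> 3\<close>, \<open>k \<ge> 4\<close>, \<open>s \<ge> 2\<close>, where no subtraction is truncated.\<close>

definition g_bound :: "nat \<Rightarrow> nat \<Rightarrow> nat \<Rightarrow> nat" where
  "g_bound s n k =
     (let r = (n - 2) div (k - 3); t = (n - 2) mod (k - 3)
      in if s \<ge> 3
         then r * ((k - 1) choose s) + ((t + 2) choose s)
         else r * ((k - 3) choose 2) + (t choose 2) + 2 * (n - 2) + 1)"

end

theory Submission
  imports Defs
begin

text \<open>
  Write \<open>q = k - 3\<close>, \<open>m = n - 2\<close> and \<open>H = G - {u, v}\<close>. A cycle of length at least \<open>k\<close> through \<open>uv\<close> amounts to a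
  path from \<open>u\<close> to \<open>v\<close> with more than \<open>q\<close> interior vertices. The bound is the number of cliques in the graph that
  arises when \<open>uv\<close> is joined completely to disjoint cliques of orders \<open>q, \<dots>, q, t\<close>. Apart from \<open>uv\<close>
  itself these are \<open>balanced_sum q s m\<close>, the sum of \<open>((i mod q) + 2) choose (s - 1)\<close> over \<open>i < m\<close>,
  and this sum is superadditive in \<open>m\<close>.

  Consider a counterexample with the fewest vertices and, among these, with the largest sum of squared
  degrees, increased by the degrees of \<open>u\<close> and \<open>v\<close>. If an edge \<open>ux\<close> spans a separator \<open>{u, x}\<close>,
  both sides satisfy the hypotheses and superadditivity gives the bound. Otherwise the Kelmans
  transformation is applied: for an edge \<open>xy\<close>, all neighbours of \<open>x\<close> outside the closed neighbourhood of \<open>y\<close>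
  are moved over to \<open>y\<close>. It neither lengthens paths from \<open>u\<close> to \<open>v\<close> (\<open>shift_path\<close>) nor reduces the number
  of cliques (\<open>clique_count_shift\<close>). It increases the chosen sum if \<open>y = u\<close> and some neighbour is moved, or
  if \<open>x, y\<close> lie in \<open>H\<close> and each has a neighbour that is neither adjacent nor equal to the other. For \<open>y = u\<close> it can destroy
  2-connectedness only if \<open>{u, x}\<close> is a separator or if \<open>x\<close> and \<open>u\<close> have no common neighbour; in the
  latter case \<open>x\<close> becomes pendant and is deleted. So all neighbours of \<open>u\<close> except \<open>v\<close> have their
  neighbourhoods inside that of \<open>u\<close>, which forces \<open>u\<close>, and likewise \<open>v\<close>, to be adjacent to all
  other vertices. From now on 2-connectedness is automatic. Shifts inside \<open>H\<close> show that adjacent vertices of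
  \<open>H\<close> have nested closed neighbourhoods, the separator \<open>{u, v}\<close> being excluded means that \<open>H\<close> is
  connected, and every edge added to \<open>H\<close> creates a path with more than \<open>q\<close> interior vertices.

  In this situation (\<open>few_cliques_extremal\<close>) let \<open>B\<close> be a maximum clique of \<open>H\<close> and \<open>A\<close> a largest clique
  not contained in \<open>B\<close>. They are the closed neighbourhoods in \<open>H\<close> of two nonadjacent vertices \<open>y\<close> and
  \<open>x\<close>. The path created by the edge \<open>xy\<close> consists of two disjoint paths of \<open>H\<close> starting at \<open>x\<close> and \<open>y\<close>.
  They can be rearranged to cover exactly \<open>q + 1\<close> vertices including \<open>A \<union> B\<close>, and then a crossing argument
  in the manner of Ore yields \<open>card A + card B \<le> q + 1\<close> (\<open>crossing_bound\<close>). The vertices of \<open>H\<close> outside \<open>B\<close>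
  can be deleted one by one with at most \<open>card A - 1\<close> neighbours in \<open>H\<close> each. With \<open>card A = a + 1\<close> and
  \<open>card B = b + 1\<close> this gives at most \<open>((b + 3) choose s) + (m - 1 - b) * ((a + 2) choose (s - 1))\<close>
  cliques, which is below the bound by convexity (\<open>balanced_sum_ge\<close>).
\<close>

section \<open>Balanced sums of binomial coefficients\<close>

definition layer :: "nat \<Rightarrow> nat \<Rightarrow> nat" where
  "layer s i = (i + 2) choose (s - 1)"

text \<open>
  The number of cliques with \<open>s\<close> vertices, other than \<open>uv\<close> itself, in the extremal graph on \<open>m + 2\<close>
  vertices: the edge \<open>uv\<close> joined completely to disjoint cliques of orders \<open>q, \<dots>, q, m mod q\<close>.
  Building these cliques up vertex by vertex, a vertex that finds \<open>i\<close> predecessors in its own clique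
  sees \<open>i + 2\<close> pairwise adjacent vertices and so completes \<open>layer s i\<close> new cliques.
\<close>

definition balanced_sum :: "nat \<Rightarrow> nat \<Rightarrow> nat \<Rightarrow> nat" where
  "balanced_sum q s m = (\<Sum>i<m. layer s (i mod q))"

lemma layer_mono: "i \<le> j \<Longrightarrow> layer s i \<le> layer s j"
  unfolding layer_def by (intro binomial_right_mono) auto

lemma sum_layer:
  assumes "s \<ge> 1"
  shows "(\<Sum>i<x. layer s i) + (2 choose s) = (x + 2) choose s"
proof (induction x)
  case (Suc x)
  obtain s' where "s = Suc s'" using assms by (cases s) auto
  with Suc show ?case by (simp add: layer_def)
qed (simp add: numeral_2_eq_2)

lemma sum_initial_segment_le:
  fixes f :: "nat \<Rightarrow> nat"
  assumes "mono f" and "finite S"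
  shows "(\<Sum>i<card S. f i) \<le> sum f S"
  using assms(2)
proof (induction "card S" arbitrary: S)
  case (Suc c)
  let ?M = "Max S"
  have M: "?M \<in> S" using Suc by (intro Max_in) auto
  have "S \<subseteq> {..?M}" using Suc by auto
  then have "card S \<le> Suc ?M" using card_mono[of "{..?M}" S] by simp
  then have "f c \<le> f ?M" using Suc.hyps(2) by (intro monoD[OF assms(1)]) simp
  moreover have "(\<Sum>i<card (S - {?M}). f i) \<le> sum f (S - {?M})"
    using Suc M by (intro Suc.hyps(1)) auto
  moreover have "card (S - {?M}) = c" using Suc M by simp
  moreover have "sum f S = f ?M + sum f (S - {?M})" using M Suc.prems by (simp add: sum.remove)
  ultimately show ?case using Suc.hyps(2)[symmetric] by simp
qed simp

lemma sum_lessThan_add: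
  fixes g :: "nat \<Rightarrow> 'a :: comm_monoid_add"
  shows "(\<Sum>i<b + c. g i) = (\<Sum>i<b. g i) + (\<Sum>i<c. g (b + i))"
  by (induction c) (simp_all add: add.assoc)

text \<open>
  Whole periods contribute equally to all windows of the same length. In less than a period the residues
  are distinct, and a monotone function has its smallest sum over a set of given size on the initial
  segment, which is the window starting at \<open>0\<close>.
\<close>

lemma sum_window_le:
  assumes "q \<ge> 1"
  shows "(\<Sum>i<b. layer s (i mod q)) \<le> (\<Sum>i<b. layer s ((a + i) mod q))"
proof (induction b rule: less_induct)
  case (less b)
  have short: "(\<Sum>i<c. layer s (i mod q)) \<le> (\<Sum>i<c. layer s ((a' + i) mod q))"
    if "c \<le> q" for a' c
  proof -
    have inj: "inj_on (\<lambda>i. (a' + i) mod q) {..<c}"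
    proof (rule inj_onI)
      fix i j assume *: "i \<in> {..<c}" "j \<in> {..<c}" "(a' + i) mod q = (a' + j) mod q"
      then have "q dvd (a' + j) - (a' + i)" "q dvd (a' + i) - (a' + j)"
        by (metis mod_eq_dvd_iff_nat nat_le_linear diff_is_0_eq dvd_0_right)+
      with * that show "i = j" by (auto dest!: dvd_imp_le)
    qed
    have "(\<Sum>i<c. layer s (i mod q)) = (\<Sum>i<c. layer s i)"
      using that by (intro sum.cong) auto
    also have "\<dots> = (\<Sum>i<card ((\<lambda>i. (a' + i) mod q) ` {..<c}). layer s i)"
      using card_image[OF inj] by simp
    also have "\<dots> \<le> sum (layer s) ((\<lambda>i. (a' + i) mod q) ` {..<c})"
      by (intro sum_initial_segment_le) (auto intro: monoI layer_mono)
    also have "\<dots> = (\<Sum>i<c. layer s ((a' + i) mod q))"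
      using sum.reindex[OF inj] by simp
    finally show ?thesis .
  qed
  show ?case
  proof (cases "b \<le> q")
    case True then show ?thesis by (rule short)
  next
    case False
    then obtain b' where b: "b = q + b'" using le_Suc_ex[of q b] by auto
    have "(\<Sum>i<b'. layer s (i mod q)) \<le> (\<Sum>i<b'. layer s ((a + i) mod q))"
      using less b assms by simp
    moreover have "(a + (q + i)) mod q = (a + i) mod q" for i
      by (metis add.left_commute mod_add_self1)
    ultimately show ?thesis using short[of q a] unfolding b sum_lessThan_add by simp
  qed
qed

text \<open>
  This is what makes the bound compatible with gluing two graphs along an edge.
\<close>

lemma balanced_sum_superadditive:
  assumes "q \<ge> 1"
  shows "balanced_sum q s a + balanced_sum q s b \<le> balanced_sum q s (a + b)"
  using sum_window_le[OF assms, where a = a and b = b and s = s]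
  unfolding balanced_sum_def sum_lessThan_add by simp

lemma convex_tangent:
  fixes f :: "nat \<Rightarrow> int"
  assumes mono: "mono (\<lambda>j. f (Suc j) - f j)"
  shows "f a + (f (Suc a) - f a) * (int j - int a) \<le> f j"
proof (cases "a \<le> j")
  case True
  then show ?thesis
  proof (induction rule: dec_induct)
    case (step n)
    have "f (Suc a) - f a \<le> f (Suc n) - f n" using monoD[OF mono] step by simp
    with step show ?case by (simp add: algebra_simps)
  qed simp
next
  case False
  then have "j \<le> a" by simp
  then show ?thesis
  proof (induction rule: inc_induct)
    case (step n)
    have "f (Suc n) - f n \<le> f (Suc a) - f a" using monoD[OF mono] step by simp
    with step show ?case by (simp add: algebra_simps)
  qed simp
qed

lemma sum_mod_periods:
  fixes f :: "nat \<Rightarrow> 'a :: comm_semiring_1"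
  assumes "t \<le> q"
  shows "(\<Sum>i<r * q + t. f (i mod q)) = of_nat r * (\<Sum>i<q. f i) + (\<Sum>i<t. f i)"
proof (induction r)
  case 0
  show ?case using assms by (auto intro!: sum.cong)
next
  case (Suc r)
  have "(\<Sum>i<Suc r * q + t. f (i mod q)) = (\<Sum>i<q. f (i mod q)) + (\<Sum>i<r * q + t. f (i mod q))"
    using sum_lessThan_add[of "\<lambda>i. f (i mod q)" q "r * q + t"] by (simp add: add.assoc)
  also have "(\<Sum>i<q. f (i mod q)) = (\<Sum>i<q. f i)" by (intro sum.cong) auto
  finally show ?case using Suc by (simp add: algebra_simps)
qed

text \<open>
  The arithmetic at the end of the proof. As \<open>layer s\<close> is convex and increasing, it lies above its
  tangent at \<open>a\<close>, so that it suffices to compare the sums of the arguments: the residues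
  \<open>i mod q\<close> with \<open>b < i < m\<close> have average at least \<open>a\<close>. In the first, incomplete period only residues
  above \<open>b \<ge> a\<close> occur, at least \<open>a\<close> of them because of \<open>a + b + 1 \<le> q\<close>; they outweigh the residues
  \<open>0, \<dots>, a - 1\<close> of the last period, and a whole period has average \<open>(q - 1) / 2 \<ge> a\<close>.
\<close>

lemma balanced_sum_ge:
  assumes "s \<ge> 2" "a \<le> b" "a + b + 1 \<le> q" "q \<le> m"
  shows "(\<Sum>i<b + 1. layer s i) + (m - 1 - b) * layer s a \<le> balanced_sum q s m"
proof -
  have q: "q \<ge> 1" using assms by simp
  define \<Delta> where "\<Delta> = int (layer s (Suc a)) - int (layer s a)"
  have \<Delta>0: "\<Delta> \<ge> 0" unfolding \<Delta>_def using layer_mono[of a "Suc a" s] by simp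
  have step: "int (layer s (Suc j)) - int (layer s j) = int ((j + 2) choose (s - 2))" for j
  proof -
    obtain s' where "s = Suc (Suc s')" using assms(1) by (metis add_2_eq_Suc le_Suc_ex)
    then show ?thesis by (simp add: layer_def)
  qed
  have tangent: "int (layer s a) + \<Delta> * (int j - int a) \<le> int (layer s j)" for j
    unfolding \<Delta>_def
    by (rule convex_tangent, rule monoI, simp only: step)
       (simp add: binomial_right_mono)
  have split: "(\<Sum>i<m. f i) = (\<Sum>i<b + 1. f i) + (\<Sum>i\<in>{b+1..<m}. f i)" for f :: "nat \<Rightarrow> int"
    using assms sum.atLeastLessThan_concat[of 0 "b+1" m f] by (simp add: lessThan_atLeast0)
  define g where "g = (\<lambda>i. int (i mod q) - int a)"
  have full: "2 * (\<Sum>i<c. int i - int a) = int c * (int c - 1 - 2 * int a)" for c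
    by (induction c) (simp_all add: algebra_simps)
  have nonneg: "0 \<le> (\<Sum>i\<in>{b+1..<m}. g i)"
  proof -
    define r t where "r = m div q" and "t = m mod q"
    have m: "m = r * q + t" unfolding r_def t_def by simp
    have "r \<ge> 1" unfolding r_def using assms q by (simp add: Suc_le_eq div_greater_zero_iff)
    have "t \<le> q" unfolding t_def using q by (simp add: less_imp_le)
    have m2: "2 * (\<Sum>i<m. g i) = int r * (int q * (int q - 1 - 2 * int a)) + int t * (int t - 1 - 2 * int a)"
      unfolding m g_def sum_mod_periods[OF \<open>t \<le> q\<close>, where f = "\<lambda>i. int i - int a"]
      by (simp only: distrib_left mult.left_commute[of 2 "int r"] full)
    \<comment> \<open>In doubled form: whole periods (1), the last incomplete period (2), and the omitted start (3).\<close>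
    have "int q - 1 - 2 * int a \<ge> int b - int a" "int q \<ge> int b + 1 + int a" using assms by linarith+
    then have "(int b + 1 + int a) * (int b - int a) \<le> int q * (int q - 1 - 2 * int a)"
      using assms by (intro mult_mono) auto
    also have "\<dots> \<le> int r * (int q * (int q - 1 - 2 * int a))"
      using \<open>r \<ge> 1\<close> assms mult_right_mono[of 1 "int r" "int q * (int q - 1 - 2 * int a)"] by simp
    finally have 1: "(int b + 1 + int a) * (int b - int a) \<le> int r * (int q * (int q - 1 - 2 * int a))" .
    have 2: "0 \<le> (int t - int a) * (int t - int a - 1)"
    proof (cases "int t \<le> int a")
      case True then show ?thesis by (intro mult_nonpos_nonpos) auto
    next
      case False then show ?thesis by (intro mult_nonneg_nonneg) auto
    qed
    have 3: "2 * (\<Sum>i<b+1. g i) = (int b + 1) * (int b - 2 * int a)" 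
    proof -
      have "(\<Sum>i<b+1. g i) = (\<Sum>i<b+1. int i - int a)"
        unfolding g_def using assms(3) by (intro sum.cong) auto
      then show ?thesis using full[of "b+1"] by simp
    qed
    have 4: "int a * int a \<le> int a * int b" using assms by (intro mult_left_mono) auto
    have "2 * (\<Sum>i\<in>{b+1..<m}. g i) = 2 * (\<Sum>i<m. g i) - 2 * (\<Sum>i<b+1. g i)"
      using split[of g] by simp
    then show ?thesis using m2 1 2 3 4 by (simp add: algebra_simps)
  qed
  have "(\<Sum>i<b+1. int (layer s (i mod q))) = (\<Sum>i<b+1. int (layer s i))"
    using assms by (intro sum.cong) auto
  moreover have "int (m - 1 - b) * int (layer s a) \<le> (\<Sum>i\<in>{b+1..<m}. int (layer s (i mod q)))"
  proof -
    have "int (m - 1 - b) * int (layer s a) + \<Delta> * (\<Sum>i\<in>{b+1..<m}. g i) 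
        = (\<Sum>i\<in>{b+1..<m}. int (layer s a) + \<Delta> * g i)"
      by (simp add: sum.distrib sum_distrib_left)
    also have "\<dots> \<le> (\<Sum>i\<in>{b+1..<m}. int (layer s (i mod q)))"
      unfolding g_def by (intro sum_mono tangent)
    finally show ?thesis using mult_nonneg_nonneg[OF \<Delta>0 nonneg] by linarith
  qed
  ultimately have "int ((\<Sum>i<b + 1. layer s i) + (m - 1 - b) * layer s a) \<le> int (balanced_sum q s m)"
    unfolding balanced_sum_def using split[of "\<lambda>i. int (layer s (i mod q))"] by simp
  then show ?thesis by (simp only: of_nat_le_iff)
qed

section \<open>Counting cliques\<close>

definition clique :: "('a \<Rightarrow> 'a \<Rightarrow> bool) \<Rightarrow> 'a set \<Rightarrow> bool" where
  "clique E K \<longleftrightarrow> (\<forall>x\<in>K. \<forall>y\<in>K. x \<noteq> y \<longrightarrow> E x y)"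

definition clique_count :: "'a set \<Rightarrow> ('a \<Rightarrow> 'a \<Rightarrow> bool) \<Rightarrow> nat \<Rightarrow> nat" where
  "clique_count V E s = card {K. K \<subseteq> V \<and> card K = s \<and> clique E K}"

lemma clique_subset: "clique E K \<Longrightarrow> L \<subseteq> K \<Longrightarrow> clique E L"
  unfolding clique_def by blast

lemma clique_count_mono:
  assumes "finite V'" "V \<subseteq> V'" "\<And>x y. x \<in> V \<Longrightarrow> y \<in> V \<Longrightarrow> x \<noteq> y \<Longrightarrow> E x y \<Longrightarrow> E' x y"
  shows "clique_count V E s \<le> clique_count V' E' s"
  unfolding clique_count_def
proof (rule card_mono)
  show "finite {K. K \<subseteq> V' \<and> card K = s \<and> clique E' K}" using assms(1) by simp
  show "{K. K \<subseteq> V \<and> card K = s \<and> clique E K} \<subseteq> {K. K \<subseteq> V' \<and> card K = s \<and> clique E' K}"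
    using assms(2,3) by (auto simp: clique_def subset_iff)
qed

lemma clique_count_le_choose:
  assumes "finite V"
  shows "clique_count V E s \<le> card V choose s"
proof -
  have "clique_count V E s \<le> card {K. K \<subseteq> V \<and> card K = s}"
    unfolding clique_count_def using assms by (intro card_mono) auto
  then show ?thesis using n_subsets[OF assms] by simp
qed

lemma clique_count_insert:
  assumes "finite W" "z \<notin> W" "s \<ge> 1"
  shows "clique_count (insert z W) E s
    \<le> clique_count W E s + (card {w \<in> W. E z w} choose (s - 1))"
proof -
  let ?N = "{w \<in> W. E z w}"
  have "{K. K \<subseteq> insert z W \<and> card K = s \<and> clique E K}
      \<subseteq> {K. K \<subseteq> W \<and> card K = s \<and> clique E K} \<union> insert z ` {L. L \<subseteq> ?N \<and> card L = s - 1}"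
  proof
    fix K assume K: "K \<in> {K. K \<subseteq> insert z W \<and> card K = s \<and> clique E K}"
    show "K \<in> {K. K \<subseteq> W \<and> card K = s \<and> clique E K} \<union> insert z ` {L. L \<subseteq> ?N \<and> card L = s - 1}"
    proof (cases "z \<in> K")
      case False then show ?thesis using K by auto
    next
      case True
      have "K = insert z (K - {z})" using True by auto
      moreover have "K - {z} \<subseteq> ?N" using K True unfolding clique_def by auto
      moreover have "card (K - {z}) = s - 1" using K True by simp
      ultimately show ?thesis by blast
    qed
  qed
  then have "clique_count (insert z W) E s
      \<le> card ({K. K \<subseteq> W \<and> card K = s \<and> clique E K} \<union> insert z ` {L. L \<subseteq> ?N \<and> card L = s - 1})"
    unfolding clique_count_def using assms(1) by (intro card_mono) auto
  also have "\<dots> \<le> clique_count W E s + card (insert z ` {L. L \<subseteq> ?N \<and> card L = s - 1})"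
    unfolding clique_count_def by (rule card_Un_le)
  also have "card (insert z ` {L. L \<subseteq> ?N \<and> card L = s - 1}) \<le> card {L. L \<subseteq> ?N \<and> card L = s - 1}"
    using assms(1) by (intro card_image_le) auto
  also have "\<dots> = card ?N choose (s - 1)" using assms(1) by (simp add: n_subsets)
  finally show ?thesis by simp
qed

text \<open>
  If the vertices outside \<open>B\<close> can be deleted one after the other, each having at most \<open>d\<close> neighbours
  when its turn comes, then every deletion destroys at most \<open>d choose (s - 1)\<close> cliques.
\<close>

lemma clique_count_degenerate:
  assumes "finite W" "B \<subseteq> W" "s \<ge> 1"
    and "\<And>W'. B \<subset> W' \<Longrightarrow> W' \<subseteq> W \<Longrightarrow> \<exists>z\<in>W' - B. card {w \<in> W' - {z}. E z w} \<le> d"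
  shows "clique_count W E s \<le> (card B choose s) + card (W - B) * (d choose (s - 1))"
  using assms
proof (induction "card (W - B)" arbitrary: W)
  case 0
  then have "W = B" by auto
  with 0 show ?case using clique_count_le_choose[of W E s] by simp
next
  case (Suc c)
  have "B \<subset> W" using Suc(2,4) by auto
  with Suc.prems obtain z where z: "z \<in> W - B" "card {w \<in> W - {z}. E z w} \<le> d" by blast
  have c: "card (W - {z} - B) = c"
  proof -
    have "W - {z} - B = (W - B) - {z}" by auto
    then show ?thesis using Suc.hyps(2)[symmetric] z by (simp add: card_Diff_singleton)
  qed
  have "clique_count (W - {z}) E s \<le> (card B choose s) + card (W - {z} - B) * (d choose (s - 1))"
  proof (rule Suc.hyps(1))
    show "B \<subseteq> W - {z}" using Suc.prems(2) z(1) by auto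
    show "\<exists>y\<in>W' - B. card {w \<in> W' - {y}. E y w} \<le> d" if "B \<subset> W'" "W' \<subseteq> W - {z}" for W'
      using that Suc.prems(4)[of W'] by blast
  qed (use Suc.prems c in auto)
  moreover have "clique_count W E s
      \<le> clique_count (W - {z}) E s + (card {w \<in> W - {z}. E z w} choose (s - 1))"
    using clique_count_insert[of "W - {z}" z s E] Suc.prems z by (simp add: insert_absorb)
  moreover have "card {w \<in> W - {z}. E z w} choose (s - 1) \<le> d choose (s - 1)"
    using z by (intro binomial_right_mono)
  ultimately show ?case using c Suc.hyps(2)[symmetric] by simp
qed

text \<open>
  No clique crosses the separator \<open>{u, x}\<close>; the only ones counted on both sides are those inside it.
\<close>

lemma clique_count_glue:
  assumes "finite V" "V1 \<union> V2 = V" "V1 \<inter> V2 = {u, x}" "u \<noteq> x" "E u x" "symp E"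
    and "\<And>d w. d \<in> V1 - {u, x} \<Longrightarrow> w \<in> V2 - {u, x} \<Longrightarrow> \<not> E d w"
  shows "clique_count V E s + (2 choose s) = clique_count V1 E s + clique_count V2 E s"
proof -
  let ?C = "\<lambda>V. {K. K \<subseteq> V \<and> card K = s \<and> clique E K}"
  have fin: "finite V1" "finite V2" using assms(1,2) by auto
  have "?C V = ?C V1 \<union> ?C V2"
  proof
    show "?C V \<subseteq> ?C V1 \<union> ?C V2"
    proof
      fix K assume K: "K \<in> ?C V"
      have "K \<subseteq> V1 \<or> K \<subseteq> V2"
      proof (rule ccontr)
        assume "\<not> (K \<subseteq> V1 \<or> K \<subseteq> V2)"
        then obtain d w where "d \<in> K" "d \<notin> V2" "w \<in> K" "w \<notin> V1" by auto
        then have "d \<in> V1 - {u, x}" "w \<in> V2 - {u, x}" "d \<noteq> w"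
          using K assms(2,3) by blast+
        moreover have "E d w"
          using K \<open>d \<in> K\<close> \<open>w \<in> K\<close> \<open>d \<noteq> w\<close> unfolding clique_def by blast
        ultimately show False using assms(7) by blast
      qed
      then show "K \<in> ?C V1 \<union> ?C V2" using K by auto
    qed
  qed (use assms(2) in auto)
  moreover have "?C V1 \<inter> ?C V2 = {K. K \<subseteq> {u, x} \<and> card K = s}"
  proof -
    have "clique E {u, x}" using assms(5,6) unfolding clique_def symp_def by blast
    then have "clique E K" if "K \<subseteq> {u, x}" for K using that clique_subset by blast
    moreover have "K \<subseteq> V1 \<and> K \<subseteq> V2 \<longleftrightarrow> K \<subseteq> {u, x}" for K using assms(3) by blast
    ultimately show ?thesis by blast
  qed
  moreover have "card {K. K \<subseteq> {u, x} \<and> card K = s} = 2 choose s"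
    using assms(4) n_subsets[of "{u, x}" s] by (simp add: numeral_2_eq_2)
  moreover have "card (?C V1) + card (?C V2) = card (?C V1 \<union> ?C V2) + card (?C V1 \<inter> ?C V2)"
    using fin by (intro card_Un_Int) auto
  ultimately show ?thesis unfolding clique_count_def by simp
qed

text \<open>
  The Kelmans transformation (edge switching) from \<open>x\<close> to \<open>y\<close>, used for adjacent \<open>x\<close> and \<open>y\<close>: every
  neighbour of \<open>x\<close> that is neither \<open>y\<close> nor adjacent to \<open>y\<close> is detached from \<open>x\<close> and attached to \<open>y\<close>.
  Afterwards the neighbours of \<open>x\<close> other than \<open>y\<close> are the former common neighbours.
\<close>

definition shift :: "('a \<Rightarrow> 'a \<Rightarrow> bool) \<Rightarrow> 'a \<Rightarrow> 'a \<Rightarrow> 'a \<Rightarrow> 'a \<Rightarrow> bool" where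
  "shift E x y a b =
    (if a = x then E x b \<and> (b = y \<or> E y b)
     else if b = x then E x a \<and> (a = y \<or> E y a)
     else if a = y then b \<noteq> y \<and> (E y b \<or> E x b)
     else if b = y then E y a \<or> E x a
     else E a b)"

lemma shift_symp:
  assumes "symp E"
  shows "symp (shift E x y)"
proof (rule sympI)
  fix a b assume "shift E x y a b"
  moreover have "E a b \<longleftrightarrow> E b a" using assms unfolding symp_def by blast
  ultimately show "shift E x y b a" unfolding shift_def by (auto split: if_splits)
qed

lemma shift_irreflp: "irreflp E \<Longrightarrow> irreflp (shift E x y)"
  unfolding irreflp_def shift_def by auto

text \<open>
  A clique destroyed by the shift contains \<open>x\<close> and some vertex not adjacent to \<open>y\<close>, hence not \<open>y\<close>.
  Exchanging \<open>x\<close> for \<open>y\<close> turns it into a clique of the new graph that was not a clique before; so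
  this exchange, extended by the identity, is injective.
\<close>

lemma clique_count_shift:
  assumes "finite V" "symp E" "irreflp E" "x \<in> V" "y \<in> V" "E x y"
  shows "clique_count V E s \<le> clique_count V (shift E x y) s"
proof -
  let ?E = "shift E x y"
  let ?C = "\<lambda>E. {K. K \<subseteq> V \<and> card K = s \<and> clique E K}"
  have xy: "x \<noteq> y" using assms unfolding irreflp_def by auto
  have sym: "E a b \<longleftrightarrow> E b a" for a b using assms(2) unfolding symp_def by auto
  define f where "f K = (if clique ?E K then K else insert y (K - {x}))" for K
  have moved: "x \<in> K" "y \<notin> K" "clique ?E (insert y (K - {x}))" "\<not> clique E (insert y (K - {x}))"
    if K: "clique E K" "\<not> clique ?E K" for K
  proof -
    have *: "E a b" if "a \<in> K" "b \<in> K" "a \<noteq> b" for a b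
      using K(1) that unfolding clique_def by auto
    from K(2) obtain a b where ab: "a \<in> K" "b \<in> K" "a \<noteq> b" "\<not> ?E a b" unfolding clique_def by auto
    then have "E a b" using * by auto
    then have "(a = x \<and> b \<noteq> y \<and> \<not> E y b) \<or> (b = x \<and> a \<noteq> y \<and> \<not> E y a)"
      using ab(3,4) sym unfolding shift_def by (auto split: if_splits)
    then obtain w where w: "w \<in> K" "x \<in> K" "w \<noteq> y" "w \<noteq> x" "\<not> E y w" using ab by blast
    show "x \<in> K" by (rule w(2))
    show "y \<notin> K" using *[of y w] w by auto
    show "\<not> clique E (insert y (K - {x}))" using w unfolding clique_def by auto
    have "?E y b" if "b \<in> K - {x}" "b \<noteq> y" for b
      using that *[OF w(2), of b] xy unfolding shift_def by auto
    moreover have "?E a b" if "a \<in> K - {x}" "b \<in> K - {x}" "a \<noteq> b" for a b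
      using * that \<open>y \<notin> K\<close> unfolding shift_def by auto
    ultimately show "clique ?E (insert y (K - {x}))"
      using shift_symp[OF assms(2)] unfolding clique_def symp_def by blast
  qed
  have "card (?C E) \<le> card (?C ?E)"
  proof (rule card_inj_on_le)
    show "f ` ?C E \<subseteq> ?C ?E"
    proof
      fix L assume "L \<in> f ` ?C E"
      then obtain K where K: "K \<subseteq> V" "card K = s" "clique E K" "L = f K" by auto
      show "L \<in> ?C ?E"
      proof (cases "clique ?E K")
        case True then show ?thesis using K unfolding f_def by auto
      next
        case False
        have "finite K" using K assms(1) finite_subset by auto
        then have "card (insert y (K - {x})) = card K"
          using moved(1,2)[OF K(3) False] card_Suc_Diff1[of K x] by simp
        then show ?thesis using K False moved[OF K(3) False] assms unfolding f_def by auto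
      qed
    qed
    show "inj_on f (?C E)"
    proof (rule inj_onI)
      fix K L assume KL: "K \<in> ?C E" "L \<in> ?C E" "f K = f L"
      have "clique ?E K \<longleftrightarrow> clique ?E L"
        using KL moved(4)[of K] moved(4)[of L] unfolding f_def by (auto split: if_splits)
      moreover have "K = L" if "\<not> clique ?E K" "\<not> clique ?E L"
      proof -
        have "insert y (K - {x}) = insert y (L - {x})" using KL that unfolding f_def by auto
        moreover have "x \<in> K" "y \<notin> K" "x \<in> L" "y \<notin> L"
          using moved(1,2)[of K] moved(1,2)[of L] KL that by blast+
        moreover have "K = insert x (insert y (K - {x}) - {y})" "L = insert x (insert y (L - {x}) - {y})"
          using \<open>x \<in> K\<close> \<open>y \<notin> K\<close> \<open>x \<in> L\<close> \<open>y \<notin> L\<close> by blast+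
        ultimately show ?thesis by simp
      qed
      ultimately show "K = L" using KL unfolding f_def by (auto split: if_splits)
    qed
    show "finite (?C ?E)" using assms(1) by auto
  qed
  then show ?thesis unfolding clique_count_def .
qed

section \<open>Paths under the Kelmans transformation\<close>

definition is_path :: "'a set \<Rightarrow> ('a \<Rightarrow> 'a \<Rightarrow> bool) \<Rightarrow> 'a \<Rightarrow> 'a \<Rightarrow> 'a list \<Rightarrow> bool" where
  "is_path V E u v p \<longleftrightarrow> p \<noteq> [] \<and> hd p = u \<and> last p = v \<and> distinct p \<and> set p \<subseteq> V \<and> successively E p"

lemma is_path_rev: "symp E \<Longrightarrow> is_path V E u v p \<Longrightarrow> is_path V E v u (rev p)"
  unfolding is_path_def symp_def
  by (auto simp: hd_rev last_rev elim: successively_mono)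

lemma is_path_mono: "is_path V E u v p \<Longrightarrow> V \<subseteq> V' \<Longrightarrow> is_path V' E u v p"
  unfolding is_path_def by auto

text \<open>
  A path of the shifted graph that meets \<open>y\<close> is repaired at \<open>y\<close> and, if it meets \<open>x\<close> as well, at both
  places. Apart from \<open>y\<close>, the neighbours of \<open>x\<close> on it are then common neighbours of \<open>x\<close> and \<open>y\<close> in the old graph,
  while each neighbour of \<open>y\<close> is joined to \<open>x\<close> or to \<open>y\<close> there. According to which, one keeps the path,
  inserts \<open>x\<close> next to \<open>y\<close>, replaces \<open>y\<close> by \<open>x\<close> (and conversely), or reverses the part between them. The end \<open>v\<close>
  must differ from \<open>x\<close> so that \<open>x\<close> has a successor.
\<close>

lemma shift_path_aux:
  assumes sym: "symp E" and "irreflp E" "E x y"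
    and path: "is_path V (shift E x y) u v (A @ y # B)"
    and x: "x \<in> V" "x \<noteq> v" "x \<notin> set A"
  shows "\<exists>p. is_path V E u v p \<and> length (A @ y # B) \<le> length p"
proof -
  have xy: "x \<noteq> y" using assms unfolding irreflp_def by auto
  have com: "E a b \<longleftrightarrow> E b a" for a b using sym unfolding symp_def by auto
  have sh: "shift E x y a b \<longleftrightarrow> E a b" if "a \<noteq> x" "a \<noteq> y" "b \<noteq> x" "b \<noteq> y" for a b
    using that unfolding shift_def by simp
  have shy: "E a y \<or> E a x" if "shift E x y a y" "a \<noteq> x" for a
    using that com unfolding shift_def by (auto split: if_splits)
  have yshy: "E y b \<or> E x b" if "shift E x y y b" "b \<noteq> x" for b
    using that xy unfolding shift_def by (auto split: if_splits)
  have shx: "E a x \<and> E a y" if "shift E x y a x" "a \<noteq> y" "a \<noteq> x" for a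
    using that com unfolding shift_def by (auto split: if_splits)
  have xsh: "E x b \<and> E y b" if "shift E x y x b" "b \<noteq> y" for b
    using that unfolding shift_def by (auto split: if_splits)
  have sub: "successively E C" if "successively (shift E x y) C" "x \<notin> set C" "y \<notin> set C" for C
    using that(1)
  proof (rule successively_mono)
    fix a b assume "a \<in> set C" "b \<in> set C" "shift E x y a b"
    then show "E a b" using sh[of a b] that(2,3) by metis
  qed
  from path have dist: "distinct (A @ y # B)" and V: "set A \<subseteq> V" "set B \<subseteq> V" "y \<in> V"
    and hd: "hd (A @ y # B) = u" and last: "last (A @ y # B) = v"
    and suc: "successively (shift E x y) A" "successively (shift E x y) B"
      "A \<noteq> [] \<Longrightarrow> shift E x y (last A) y" "B \<noteq> [] \<Longrightarrow> shift E x y y (hd B)"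
    unfolding is_path_def by (auto simp: successively_append_iff successively_Cons)
  have A: "successively E A" using sub suc(1) x(3) dist by auto
  have lA: "E (last A) y \<or> E (last A) x" if "A \<noteq> []"
    using shy[OF suc(3)[OF that]] that x(3) last_in_set by blast
  show ?thesis
  proof (cases "x \<in> set B")
    case False
    have B: "successively E B" using sub suc(2) False dist by auto
    have hB: "E y (hd B) \<or> E x (hd B)" if "B \<noteq> []"
      using yshy[OF suc(4)[OF that]] that False hd_in_set by blast
    consider (good) "A \<noteq> [] \<Longrightarrow> E (last A) y" "B \<noteq> [] \<Longrightarrow> E y (hd B)"
      | (right) "A \<noteq> [] \<Longrightarrow> E (last A) y" "B \<noteq> []" "E x (hd B)"
      | (left) "A \<noteq> []" "E (last A) x" "B \<noteq> [] \<Longrightarrow> E y (hd B)"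
      | (both) "A \<noteq> []" "E (last A) x" "B \<noteq> []" "E x (hd B)"
      using lA hB by blast
    then show ?thesis
    proof cases
      case good
      then have "is_path V E u v (A @ y # B)"
        using A B dist V hd last unfolding is_path_def
        by (auto simp: successively_append_iff successively_Cons)
      then show ?thesis by blast
    next
      case right
      then have "is_path V E u v (A @ y # x # B)"
        using A B dist V hd last x False xy com[of x y] \<open>E x y\<close> unfolding is_path_def
        by (auto simp: successively_append_iff successively_Cons hd_append)
      then show ?thesis by (intro exI[of _ "A @ y # x # B"]) simp
    next
      case left
      then have "is_path V E u v (A @ x # y # B)"
        using A B dist V hd last x False xy com[of x y] \<open>E x y\<close> unfolding is_path_def
        by (auto simp: successively_append_iff successively_Cons hd_append)
      then show ?thesis by (intro exI[of _ "A @ x # y # B"]) simp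
    next
      case both
      then have "is_path V E u v (A @ x # B)"
        using A B dist V hd last x False unfolding is_path_def
        by (auto simp: successively_append_iff successively_Cons hd_append)
      then show ?thesis by (intro exI[of _ "A @ x # B"]) simp
    qed
  next
    case True
    \<comment> \<open>\<open>M\<close> is the part of the path between \<open>y\<close> and \<open>x\<close>; it is reversed if exactly one side of \<open>y\<close> changes over to \<open>x\<close>.\<close>
    then obtain M C where B: "B = M @ x # C" by (auto dest: split_list)
    have "C \<noteq> []" using last B x(2) by auto
    have M: "successively E M" and C: "successively E C" 
      using suc(2) sub dist unfolding B by (auto simp: successively_append_iff successively_Cons)
    have nC: "hd C \<noteq> y" "hd C \<noteq> x" using \<open>C \<noteq> []\<close> dist unfolding B by (auto simp: hd_in_set dest: hd_in_set)
    have hC: "E x (hd C)" "E y (hd C)"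
      using xsh[of "hd C"] suc(2) \<open>C \<noteq> []\<close> nC unfolding B
      by (auto simp: successively_append_iff successively_Cons)
    show ?thesis
    proof (cases "M = []")
      case True
      show ?thesis
      proof (cases "A = [] \<or> E (last A) y")
        case left: True
        have "is_path V E u v (A @ y # x # C)"
          using left A C hC dist V hd last x xy com[of x y] \<open>E x y\<close> \<open>C \<noteq> []\<close> unfolding is_path_def B True
          by (auto simp: successively_append_iff successively_Cons hd_append)
        then show ?thesis unfolding B True by (intro exI[of _ "A @ y # x # C"]) simp
      next
        case left: False
        then have "E (last A) x" using lA by blast
        then have "is_path V E u v (A @ x # y # C)"
          using left A C hC dist V hd last x xy com[of x y] \<open>E x y\<close> \<open>C \<noteq> []\<close> unfolding is_path_def B True
          by (auto simp: successively_append_iff successively_Cons hd_append)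
        then show ?thesis unfolding B True by (intro exI[of _ "A @ x # y # C"]) simp
      qed
    next
      case False
      have nM: "last M \<noteq> y" "last M \<noteq> x" "hd M \<noteq> y" "hd M \<noteq> x"
        using False dist unfolding B by (auto dest: hd_in_set last_in_set)
      have lM: "E (last M) x" "E (last M) y"
        using shx[of "last M"] suc(2) False nM unfolding B
        by (auto simp: successively_append_iff successively_Cons)
      have hM: "E y (hd M) \<or> E x (hd M)" using yshy[of "hd M"] suc(4) False nM unfolding B by auto
      have rM: "successively E (rev M)" using M com by (auto elim: successively_mono)
      note props = A M C rM hC lM dist V hd last x xy \<open>E x y\<close> \<open>C \<noteq> []\<close> False
      have *: "\<exists>p. is_path V E u v p \<and> length (A @ y # B) \<le> length p"
        if "is_path V E u v p" "length p = length A + length M + length C + 2" for p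
        using that unfolding B by (intro exI[of _ p]) simp
      consider (good) "A \<noteq> [] \<Longrightarrow> E (last A) y" "E y (hd M)"
        | (right) "A \<noteq> [] \<Longrightarrow> E (last A) y" "E x (hd M)"
        | (left) "A \<noteq> []" "E (last A) x" "E y (hd M)"
        | (both) "A \<noteq> []" "E (last A) x" "E x (hd M)"
        using lA hM by blast
      then show ?thesis
      proof cases
        case good
        then have "is_path V E u v (A @ y # M @ x # C)"
          using props unfolding is_path_def B
          by (auto simp: successively_append_iff successively_Cons hd_append)
        then show ?thesis by (rule *) simp
      next
        case right
        then have "is_path V E u v (A @ y # rev M @ x # C)"
          using props com[of y "last M"] com[of "hd M" x] unfolding is_path_def B
          by (auto simp: successively_append_iff successively_Cons hd_append hd_rev last_rev simp del: successively_rev)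
        then show ?thesis by (rule *) simp
      next
        case left
        then have "is_path V E u v (A @ x # rev M @ y # C)"
          using props com[of x "last M"] com[of "hd M" y] unfolding is_path_def B
          by (auto simp: successively_append_iff successively_Cons hd_append hd_rev last_rev simp del: successively_rev)
        then show ?thesis by (rule *) simp
      next
        case both
        then have "is_path V E u v (A @ x # M @ y # C)"
          using props unfolding is_path_def B
          by (auto simp: successively_append_iff successively_Cons hd_append)
        then show ?thesis by (rule *) simp
      qed
    qed
  qed
qed

text \<open>
  The shift does not lengthen the longest path between two vertices other than \<open>x\<close>,
  one of which may be \<open>y\<close>. If \<open>x\<close> precedes \<open>y\<close>, the path is read backwards.
\<close>

lemma shift_path:
  assumes "symp E" "irreflp E" "E x y" "x \<in> V" "x \<noteq> u" "x \<noteq> v"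
    and path: "is_path V (shift E x y) u v p"
  shows "\<exists>p'. is_path V E u v p' \<and> length p \<le> length p'"
proof (cases "y \<in> set p")
  case False
  have "E a b" if "a \<in> set p" "b \<in> set p" "shift E x y a b" for a b
    using that False \<open>symp E\<close> unfolding shift_def symp_def by (auto split: if_splits)
  then have "is_path V E u v p" using path unfolding is_path_def by (auto elim: successively_mono)
  then show ?thesis by blast
next
  case True
  then obtain A B where p: "p = A @ y # B" by (auto dest: split_list)
  show ?thesis
  proof (cases "x \<in> set A")
    case False
    then show ?thesis using shift_path_aux[of E x y V u v A B] assms p by auto
  next
    case True
    have "is_path V (shift E x y) v u (rev B @ y # rev A)"
      using is_path_rev[OF shift_symp[OF assms(1)] path] p by simp
    moreover have "x \<notin> set (rev B)" using True path p unfolding is_path_def by auto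
    ultimately obtain p' where "is_path V E v u p'" "length p \<le> length p'"
      using shift_path_aux[of E x y V v u "rev B" "rev A"] assms p by auto
    then show ?thesis using is_path_rev[OF assms(1)] by (intro exI[of _ "rev p'"]) auto
  qed
qed

section \<open>Two-connectedness relative to an edge\<close>

text \<open>
  For adjacent \<open>u\<close> and \<open>v\<close> and at least three vertices this is 2-connectedness, written without walks: after deletion of any
  vertex \<open>z\<close>, no nonempty set \<open>D\<close> avoiding \<open>u\<close> and \<open>v\<close> is a union of components. In this form it
  is inherited by pieces and by modified graphs through a choice of \<open>D\<close> and \<open>z\<close>.
\<close>

definition anchored :: "'a set \<Rightarrow> ('a \<Rightarrow> 'a \<Rightarrow> bool) \<Rightarrow> 'a \<Rightarrow> 'a \<Rightarrow> bool" where
  "anchored V E u v \<longleftrightarrow>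
     (\<forall>z\<in>V. \<forall>D. D \<noteq> {} \<and> D \<subseteq> V - {u, v, z} \<longrightarrow> (\<exists>d\<in>D. \<exists>w\<in>V - D - {z}. E d w))"

lemma anchoredD:
  assumes "anchored V E u v" "z \<in> V" "D \<noteq> {}" "D \<subseteq> V - {u, v, z}"
  obtains d w where "d \<in> D" "w \<in> V" "w \<notin> D" "w \<noteq> z" "E d w"
proof -
  have "\<exists>d\<in>D. \<exists>w\<in>V - D - {z}. E d w" using assms unfolding anchored_def by simp
  then show thesis using that by blast
qed

lemma anchored_swap: "anchored V E u v \<Longrightarrow> anchored V E v u"
  unfolding anchored_def by (simp add: insert_commute)

lemma anchored_dominating:
  assumes "u \<in> V" "v \<in> V" "u \<noteq> v"
    and "\<And>w. w \<in> V - {u, v} \<Longrightarrow> E w u \<and> E w v"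
  shows "anchored V E u v"
  unfolding anchored_def
proof (intro ballI allI impI)
  fix z D assume z: "z \<in> V" and D: "D \<noteq> {} \<and> D \<subseteq> V - {u, v, z}"
  then obtain d where "d \<in> D" by blast
  then have "E d u" "E d v" using D assms(4)[of d] by auto
  moreover have "u \<in> V - D - {z} \<or> v \<in> V - D - {z}" using D assms(1-3) by blast
  ultimately show "\<exists>d\<in>D. \<exists>w\<in>V - D - {z}. E d w" using \<open>d \<in> D\<close> by blast
qed

lemma anchored_add_vertex:
  assumes "anchored (V - {x}) E u v" "u \<in> V" "x \<noteq> u"
    and "E x u" "E x c" "c \<in> V" "c \<noteq> x" "c \<noteq> u"
  shows "anchored V E u v"
  unfolding anchored_def
proof (intro ballI allI impI)
  fix z D assume z: "z \<in> V" and D: "D \<noteq> {} \<and> D \<subseteq> V - {u, v, z}"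
  show "\<exists>d\<in>D. \<exists>w\<in>V - D - {z}. E d w"
  proof (cases "D = {x}")
    case True
    then show ?thesis using assms(2-8) z D by blast
  next
    case False
    \<comment> \<open>If \<open>x\<close> itself is deleted, delete \<open>u\<close> instead; it lies outside \<open>D\<close> anyway.\<close>
    define z' where "z' = (if z = x then u else z)"
    have "z' \<in> V - {x}" using z assms(2,3) unfolding z'_def by auto
    moreover have "D - {x} \<noteq> {}" "D - {x} \<subseteq> V - {x} - {u, v, z'}"
      using D False unfolding z'_def by auto
    ultimately obtain d w where "d \<in> D - {x}" "w \<in> V - {x}" "w \<notin> D - {x}" "w \<noteq> z'" "E d w"
      using anchoredD[OF assms(1)] by metis
    then show ?thesis unfolding z'_def by (intro bexI[of _ d] bexI[of _ w]) (auto split: if_splits)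
  qed
qed

text \<open>
  The set of vertices without such a path would violate the condition with \<open>z = u\<close>.
\<close>

lemma anchored_path:
  assumes "anchored V E u v" "u \<in> V" "v \<in> V" "v \<noteq> u" "x \<in> V" "x \<noteq> u"
  shows "\<exists>p. is_path (V - {u}) E x v p"
proof (rule ccontr)
  assume no: "\<nexists>p. is_path (V - {u}) E x v p"
  define D where "D = {d \<in> V - {u}. \<nexists>p. is_path (V - {u}) E d v p}"
  have "is_path (V - {u}) E v v [v]" using assms unfolding is_path_def by auto
  then have "v \<notin> D" unfolding D_def by blast
  then have "D \<subseteq> V - {u, v, u}" "D \<noteq> {}" using assms no unfolding D_def by auto
  then obtain d w where dw: "d \<in> D" "w \<in> V" "w \<notin> D" "w \<noteq> u" "E d w"
    using anchoredD[OF assms(1,2)] by metis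
  then obtain p where p: "is_path (V - {u}) E w v p" unfolding D_def by blast
  have "\<exists>p. is_path (V - {u}) E d v p"
  proof (cases "d \<in> set p")
    case True
    then obtain A B where "p = A @ d # B" by (auto dest: split_list)
    then have "is_path (V - {u}) E d v (d # B)" using p unfolding is_path_def
      by (auto simp: successively_append_iff)
    then show ?thesis by blast
  next
    case False
    then have "is_path (V - {u}) E d v (d # p)" using p dw unfolding is_path_def D_def
      by (auto simp: successively_Cons)
    then show ?thesis by blast
  qed
  then show False using dw(1) unfolding D_def by blast
qed

section \<open>Separators and contractions\<close>

text \<open>
  The setting of the theorem: \<open>q\<close> bounds the number of interior vertices of a path from \<open>u\<close> to \<open>v\<close>,
  and the list \<open>p\<close> includes both ends.
\<close>

definition short_pair :: "nat \<Rightarrow> 'a set \<Rightarrow> ('a \<Rightarrow> 'a \<Rightarrow> bool) \<Rightarrow> 'a \<Rightarrow> 'a \<Rightarrow> bool" where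
  "short_pair q V E u v \<longleftrightarrow> finite V \<and> symp E \<and> irreflp E \<and> u \<in> V \<and> v \<in> V \<and> E u v \<and>
     anchored V E u v \<and> (\<forall>p. is_path V E u v p \<longrightarrow> length p \<le> q + 2)"

definition few_cliques :: "nat \<Rightarrow> nat \<Rightarrow> 'a set \<Rightarrow> ('a \<Rightarrow> 'a \<Rightarrow> bool) \<Rightarrow> bool" where
  "few_cliques q s V E \<longleftrightarrow> clique_count V E s \<le> balanced_sum q s (card V - 2) + (2 choose s)"

lemma short_pair_swap: "short_pair q V E u v \<Longrightarrow> short_pair q V E v u"
  unfolding short_pair_def using is_path_rev[of E V v u] anchored_swap[of V E u v]
  by (metis length_rev sympD)

lemma short_pair_neq: "short_pair q V E u v \<Longrightarrow> u \<noteq> v"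
  unfolding short_pair_def irreflp_def by auto

text \<open>
  Both sides of a separator \<open>{u, x}\<close> spanning an edge inherit the setting, the side \<open>D\<close> with \<open>x\<close> in
  the role of \<open>v\<close>: a path from \<open>u\<close> to \<open>x\<close> through \<open>D\<close> continues to \<open>v\<close> on the other side, avoiding
  \<open>u\<close>. The case \<open>x = v\<close> is included.
\<close>

lemma short_pair_separation:
  assumes pair: "short_pair q V E u v" and x: "x \<in> V" "E u x"
    and D: "D \<noteq> {}" "D \<subseteq> V - {u, v, x}"
    and closed: "\<And>d w. d \<in> D \<Longrightarrow> w \<in> V - D - {u, x} \<Longrightarrow> \<not> E d w"
  shows "short_pair q (D \<union> {u, x}) E u x" "short_pair q (V - D) E u v"
proof -
  from pair have fin: "finite V" and sym: "symp E" and irr: "irreflp E" and uv: "u \<in> V" "v \<in> V" "E u v"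
    and anch: "anchored V E u v" and short: "\<And>p. is_path V E u v p \<Longrightarrow> length p \<le> q + 2"
    unfolding short_pair_def by auto
  have "u \<noteq> v" by (rule short_pair_neq[OF pair])
  have "u \<noteq> x" using x irr unfolding irreflp_def by auto
  have com: "E a b \<Longrightarrow> E b a" for a b using sym by (rule sympD)
  show 2: "short_pair q (V - D) E u v"
  proof -
    have "anchored (V - D) E u v"
      unfolding anchored_def
    proof (intro ballI allI impI)
      fix z D' assume z: "z \<in> V - D" and D': "D' \<noteq> {} \<and> D' \<subseteq> V - D - {u, v, z}"
      show "\<exists>d\<in>D'. \<exists>w\<in>V - D - D' - {z}. E d w"
      proof (cases "x \<in> D'")
        case False
        have "D' \<subseteq> V - {u, v, z}" "z \<in> V" using D' z by auto
        then obtain d w where dw: "d \<in> D'" "w \<in> V" "w \<notin> D'" "w \<noteq> z" "E d w"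
          using anchoredD[OF anch] D' by metis
        have "w \<notin> D" using closed[of w d] dw D' False com[of d w] by auto
        then show ?thesis using dw by blast
      next
        case True
        show ?thesis
        proof (cases "z = u")
          case False
          then have "u \<in> V - D - D' - {z}" using uv D D' by auto
          then show ?thesis using True com[OF x(2)] by blast
        next
          case z: True
          have "D \<union> D' \<noteq> {}" "D \<union> D' \<subseteq> V - {u, v, u}" using D D' by auto
          then obtain d w where "d \<in> D \<union> D'" "w \<in> V" "w \<notin> D \<union> D'" "w \<noteq> u" "E d w"
            using anchoredD[OF anch uv(1)] by metis
          then show ?thesis using closed[of d w] True z by blast
        qed
      qed
    qed
    moreover have "length p \<le> q + 2" if "is_path (V - D) E u v p" for p
      using that by (intro short) (auto intro: is_path_mono)
    ultimately show ?thesis using fin sym irr uv D unfolding short_pair_def by auto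
  qed
  show "short_pair q (D \<union> {u, x}) E u x"
  proof -
    have "anchored (D \<union> {u, x}) E u x"
      unfolding anchored_def
    proof (intro ballI allI impI)
      fix z D' assume z: "z \<in> D \<union> {u, x}" and D': "D' \<noteq> {} \<and> D' \<subseteq> D \<union> {u, x} - {u, x, z}"
      then have "D' \<subseteq> V - {u, v, z}" "z \<in> V" using D uv x by auto
      then obtain d w where dw: "d \<in> D'" "w \<in> V" "w \<notin> D'" "w \<noteq> z" "E d w"
        using anchoredD[OF anch] D' by metis
      then have "w \<in> D \<union> {u, x}" using closed[of d w] D' by blast
      then show "\<exists>d\<in>D'. \<exists>w\<in>D \<union> {u, x} - D' - {z}. E d w" using dw by blast
    qed
    moreover have "length p \<le> q + 2" if p: "is_path (D \<union> {u, x}) E u x p" for p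
    proof -
      have "\<exists>r. is_path (V - D - {u}) E x v r"
        by (rule anchored_path) (use 2 x D uv \<open>u \<noteq> v\<close> \<open>u \<noteq> x\<close> in \<open>auto simp: short_pair_def\<close>)
      then obtain r where r: "is_path (V - D - {u}) E x v r" by blast
      then obtain r' where r': "r = x # r'" unfolding is_path_def by (cases r) auto
      have "is_path V E u v (p @ r')"
        unfolding is_path_def
      proof (intro conjI)
        show "distinct (p @ r')" using p r r' unfolding is_path_def by auto
        show "set (p @ r') \<subseteq> V" using p r r' D x uv unfolding is_path_def by auto
        show "successively E (p @ r')" using p r r' unfolding is_path_def
          by (auto simp: successively_append_iff successively_Cons)
      qed (use p r r' in \<open>auto simp: is_path_def split: if_splits\<close>)
      then show ?thesis using short by fastforce
    qed
    ultimately show ?thesis using fin sym irr x D uv finite_subset[of D V] unfolding short_pair_def by auto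
  qed
qed

lemma few_cliques_glue:
  assumes pair: "short_pair q V E u v" and x: "x \<in> V" "E u x" and "q \<ge> 1"
    and D: "D \<subseteq> V - {u, v, x}"
    and closed: "\<And>d w. d \<in> D \<Longrightarrow> w \<in> V - D - {u, x} \<Longrightarrow> \<not> E d w"
    and few: "few_cliques q s (D \<union> {u, x}) E" "few_cliques q s (V - D) E"
  shows "few_cliques q s V E"
proof -
  from pair have fin: "finite V" and sym: "symp E" and irr: "irreflp E" and uv: "u \<in> V" "v \<in> V"
    unfolding short_pair_def by auto
  have "u \<noteq> v" by (rule short_pair_neq[OF pair])
  have "u \<noteq> x" using x irr unfolding irreflp_def by auto
  have finD: "finite D" using D fin finite_subset by auto
  have "clique_count V E s + (2 choose s) = clique_count (D \<union> {u, x}) E s + clique_count (V - D) E s"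
    by (rule clique_count_glue[OF fin]) (use D x uv closed sym \<open>u \<noteq> x\<close> in auto)
  moreover have "card (D \<union> {u, x}) - 2 = card D"
    using D finD \<open>u \<noteq> x\<close> by (subst card_Un_disjoint) auto
  moreover have "card V - 2 = card D + (card (V - D) - 2)"
  proof -
    have "card V = card D + card (V - D)"
      using D fin by (metis Diff_subset card_Diff_subset card_mono finD le_add_diff_inverse order_trans)
    moreover have "card {u, v} \<le> card (V - D)" using D uv fin by (intro card_mono) auto
    ultimately show ?thesis using \<open>u \<noteq> v\<close> by simp
  qed
  ultimately show ?thesis
    using few balanced_sum_superadditive[OF \<open>q \<ge> 1\<close>, of s "card D" "card (V - D) - 2"]
    unfolding few_cliques_def by simp
qed

text \<open>
  Shifting \<open>x\<close> to \<open>u\<close> and then deleting \<open>x\<close> contracts the edge \<open>ux\<close>. The contracted graph can only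
  be separated at the merged vertex, where \<open>{u, x}\<close> would separate the old graph.
\<close>

lemma short_pair_shift_remove:
  assumes pair: "short_pair q V E u v" and x: "x \<in> V" "x \<noteq> v" "E u x"
    and no_cut: "\<And>D. D \<noteq> {} \<Longrightarrow> D \<subseteq> V - {u, v, x} \<Longrightarrow> \<exists>d\<in>D. \<exists>w\<in>V - D - {u, x}. E d w"
  shows "short_pair q (V - {x}) (shift E x u) u v"
proof -
  from pair have fin: "finite V" and sym: "symp E" and irr: "irreflp E" and uv: "u \<in> V" "v \<in> V" "E u v"
    and anch: "anchored V E u v" and short: "\<And>p. is_path V E u v p \<Longrightarrow> length p \<le> q + 2"
    unfolding short_pair_def by auto
  have "u \<noteq> v" by (rule short_pair_neq[OF pair])
  have "u \<noteq> x" using x irr unfolding irreflp_def by auto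
  have "E x u" using x(3) sym by (blast dest: sympD)
  have keep: "shift E x u a b" if "E a b" "a \<noteq> x" "b \<noteq> x" for a b
    using that irr sym unfolding shift_def irreflp_def symp_def by auto
  have "anchored (V - {x}) (shift E x u) u v"
    unfolding anchored_def
  proof (intro ballI allI impI)
    fix z D assume z: "z \<in> V - {x}" and D: "D \<noteq> {} \<and> D \<subseteq> V - {x} - {u, v, z}"
    show "\<exists>d\<in>D. \<exists>w\<in>V - {x} - D - {z}. shift E x u d w"
    proof (cases "z = u")
      case True
      obtain d w where "d \<in> D" "w \<in> V - D - {u, x}" "E d w" using no_cut[of D] D by blast
      then show ?thesis using keep[of d w] D True by blast
    next
      case False
      have "D \<subseteq> V - {u, v, z}" "z \<in> V" using D z by auto
      then obtain d w where dw: "d \<in> D" "w \<in> V" "w \<notin> D" "w \<noteq> z" "E d w"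
        using anchoredD[OF anch] D by metis
      show ?thesis
      proof (cases "w = x")
        case True
        then have "shift E x u d u" using dw D sym unfolding shift_def symp_def by auto
        moreover have "u \<in> V - {x} - D - {z}" using uv D False \<open>u \<noteq> x\<close> by auto
        ultimately show ?thesis using dw(1) by blast
      next
        case False
        then show ?thesis using keep[of d w] dw D by blast
      qed
    qed
  qed
  moreover have "length p \<le> q + 2" if "is_path (V - {x}) (shift E x u) u v p" for p
    using shift_path[OF sym irr \<open>E x u\<close> x(1) _ x(2)] is_path_mono[OF that, of V] short \<open>u \<noteq> x\<close>
    by (metis Diff_subset le_trans)
  ultimately show ?thesis
    using fin uv x \<open>u \<noteq> x\<close> shift_symp[OF sym] shift_irreflp[OF irr] keep[OF uv(3)] unfolding short_pair_def by auto
qed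

lemma short_pair_shift:
  assumes pair: "short_pair q V E u v" and x: "x \<in> V" "x \<notin> {u, v}" and "E x y"
    and anch: "anchored V (shift E x y) u v"
  shows "short_pair q V (shift E x y) u v"
proof -
  from pair have fin: "finite V" and sym: "symp E" and irr: "irreflp E" and uv: "u \<in> V" "v \<in> V" "E u v"
    and short: "\<And>p. is_path V E u v p \<Longrightarrow> length p \<le> q + 2"
    unfolding short_pair_def by auto
  have "u \<noteq> v" by (rule short_pair_neq[OF pair])
  have "shift E x y u v" using uv x \<open>u \<noteq> v\<close> sym unfolding shift_def symp_def by auto
  moreover have "length p \<le> q + 2" if "is_path V (shift E x y) u v p" for p
    using shift_path[OF sym irr \<open>E x y\<close> x(1) _ _ that] short x by fastforce
  ultimately show ?thesis
    using fin uv anch shift_symp[OF sym] shift_irreflp[OF irr] unfolding short_pair_def by auto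
qed

text \<open>
  Without common neighbours of \<open>x\<close> and \<open>u\<close>, the shift leaves \<open>x\<close> with the single neighbour \<open>u\<close>.
  Deleting \<open>x\<close> then costs at most one clique, and only for \<open>s = 2\<close>.
\<close>

lemma few_cliques_shift_remove:
  assumes pair: "short_pair q V E u v" and x: "x \<in> V" "x \<noteq> v" "E u x" and "s \<ge> 2"
    and nocommon: "\<And>c. c \<in> V \<Longrightarrow> \<not> (E x c \<and> E u c)"
    and few: "few_cliques q s (V - {x}) (shift E x u)"
  shows "few_cliques q s V E"
proof -
  from pair have fin: "finite V" and sym: "symp E" and irr: "irreflp E" and uv: "u \<in> V" "v \<in> V"
    unfolding short_pair_def by auto
  have "u \<noteq> v" by (rule short_pair_neq[OF pair])
  have "u \<noteq> x" using x irr unfolding irreflp_def by auto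
  have "E x u" using x(3) sym by (blast dest: sympD)
  have "{w \<in> V - {x}. shift E x u x w} = {u}"
    using nocommon \<open>E x u\<close> uv \<open>u \<noteq> x\<close> unfolding shift_def by auto
  then have "clique_count (insert x (V - {x})) (shift E x u) s
      \<le> clique_count (V - {x}) (shift E x u) s + (1 choose (s - 1))"
    using clique_count_insert[of "V - {x}" x s "shift E x u"] fin \<open>s \<ge> 2\<close> by simp
  moreover have "insert x (V - {x}) = V" using x by auto
  moreover have "clique_count V E s \<le> clique_count V (shift E x u) s"
    by (rule clique_count_shift) (use fin sym irr x uv \<open>E x u\<close> in auto)
  moreover obtain m where m: "card V - 2 = Suc m" "card (V - {x}) - 2 = m"
  proof -
    have "card {u, v, x} \<le> card V" using uv x fin by (intro card_mono) auto
    then have "card V \<ge> 3" using \<open>u \<noteq> v\<close> \<open>u \<noteq> x\<close> x by simp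
    then show ?thesis using that[of "card V - 3"] x fin by simp
  qed
  moreover have "1 choose (s - 1) \<le> layer s (m mod q)"
    unfolding layer_def by (intro binomial_right_mono) simp
  ultimately show ?thesis using few unfolding few_cliques_def balanced_sum_def by simp
qed

section \<open>Degrees under the Kelmans transformation\<close>

definition degree :: "'a set \<Rightarrow> ('a \<Rightarrow> 'a \<Rightarrow> bool) \<Rightarrow> 'a \<Rightarrow> nat" where
  "degree V E x = card {w \<in> V. E x w}"

text \<open>
  The quantity that every modification of the graph increases. The last two summands are needed for
  a shift from \<open>x\<close> to \<open>u\<close> when \<open>N[u] \<subset> N[x]\<close>: it exchanges the degrees of the two vertices.
\<close>

definition potential :: "'a set \<Rightarrow> ('a \<Rightarrow> 'a \<Rightarrow> bool) \<Rightarrow> 'a \<Rightarrow> 'a \<Rightarrow> nat" where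
  "potential V E u v = (\<Sum>x\<in>V. (degree V E x)\<^sup>2) + degree V E u + degree V E v"

lemma degree_shift_other:
  assumes "finite V" "symp E" "x \<in> V" "y \<in> V" "w \<noteq> x" "w \<noteq> y" "x \<noteq> y"
  shows "degree V (shift E x y) w = degree V E w"
proof -
  have com: "E a b \<longleftrightarrow> E b a" for a b using assms(2) unfolding symp_def by auto
  show ?thesis
  proof (cases "E w x \<and> \<not> E w y")
    case True
    have "{z \<in> V. shift E x y w z} = insert y ({z \<in> V. E w z} - {x})"
      using True assms com[of y w] com[of x w] unfolding shift_def by auto
    moreover have "card (insert y ({z \<in> V. E w z} - {x})) = card {z \<in> V. E w z}"
      using True assms card_Suc_Diff1[of "{z \<in> V. E w z}" x] by simp
    ultimately show ?thesis unfolding degree_def by simp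
  next
    case False
    have "{z \<in> V. shift E x y w z} = {z \<in> V. E w z}"
      using False assms com[of y w] com[of x w] unfolding shift_def by auto
    then show ?thesis unfolding degree_def by simp
  qed
qed

text \<open>
  Here \<open>\<alpha>\<close> and \<open>\<beta>\<close> count the private neighbours of \<open>x\<close> and \<open>y\<close>, and \<open>\<gamma>\<close> the common ones; the shift
  moves the \<open>\<alpha>\<close> private neighbours of \<open>x\<close> over to \<open>y\<close>.
\<close>

lemma degree_shift:
  assumes "finite V" "symp E" "irreflp E" "x \<in> V" "y \<in> V" "E x y"
  defines "\<alpha> \<equiv> card {w \<in> V. E x w \<and> w \<noteq> y \<and> \<not> E y w}"
    and "\<beta> \<equiv> card {w \<in> V. E y w \<and> w \<noteq> x \<and> \<not> E x w}"
    and "\<gamma> \<equiv> card {w \<in> V. E x w \<and> E y w}"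
  shows "degree V E x = \<alpha> + \<gamma> + 1" "degree V E y = \<beta> + \<gamma> + 1"
    "degree V (shift E x y) x = \<gamma> + 1" "degree V (shift E x y) y = \<alpha> + \<beta> + \<gamma> + 1"
proof -
  have xy: "x \<noteq> y" "E y x" "\<not> E x x" "\<not> E y y" using assms unfolding irreflp_def symp_def by auto
  let ?A = "{w \<in> V. E x w \<and> w \<noteq> y \<and> \<not> E y w}" and ?B = "{w \<in> V. E y w \<and> w \<noteq> x \<and> \<not> E x w}"
    and ?C = "{w \<in> V. E x w \<and> E y w}"
  have "{w \<in> V. E x w} = insert y (?A \<union> ?C)" using assms xy by auto
  moreover have "card (insert y (?A \<union> ?C)) = \<alpha> + \<gamma> + 1"
    using assms(1) xy unfolding \<alpha>_def \<gamma>_def by (subst card_insert_disjoint) (auto intro!: card_Un_disjoint)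
  ultimately show "degree V E x = \<alpha> + \<gamma> + 1" unfolding degree_def by simp
  have "{w \<in> V. E y w} = insert x (?B \<union> ?C)" using assms xy by auto
  moreover have "card (insert x (?B \<union> ?C)) = \<beta> + \<gamma> + 1"
    using assms(1) xy unfolding \<beta>_def \<gamma>_def by (subst card_insert_disjoint) (auto intro!: card_Un_disjoint)
  ultimately show "degree V E y = \<beta> + \<gamma> + 1" unfolding degree_def by simp
  have "{w \<in> V. shift E x y x w} = insert y ?C" using assms xy unfolding shift_def by auto
  then show "degree V (shift E x y) x = \<gamma> + 1" unfolding degree_def \<gamma>_def
    using assms(1) xy by simp
  have "{w \<in> V. shift E x y y w} = insert x (?A \<union> (?B \<union> ?C))" using assms xy unfolding shift_def by auto
  moreover have "card (insert x (?A \<union> (?B \<union> ?C))) = Suc (card (?A \<union> (?B \<union> ?C)))"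
    using assms(1) xy by (subst card_insert_disjoint) auto
  moreover have "card (?A \<union> (?B \<union> ?C)) = card ?A + card (?B \<union> ?C)"
    using assms(1) by (intro card_Un_disjoint) auto
  moreover have "card (?B \<union> ?C) = card ?B + card ?C"
    using assms(1) by (intro card_Un_disjoint) auto
  ultimately show "degree V (shift E x y) y = \<alpha> + \<beta> + \<gamma> + 1"
    unfolding degree_def \<alpha>_def \<beta>_def \<gamma>_def by simp
qed

lemma sum_degree_squares_shift:
  assumes "finite V" "symp E" "irreflp E" "x \<in> V" "y \<in> V" "E x y"
  shows "(\<Sum>w\<in>V. (degree V (shift E x y) w)\<^sup>2) = (\<Sum>w\<in>V. (degree V E w)\<^sup>2)
    + 2 * card {w \<in> V. E x w \<and> w \<noteq> y \<and> \<not> E y w} * card {w \<in> V. E y w \<and> w \<noteq> x \<and> \<not> E x w}"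
proof -
  have xy: "x \<noteq> y" using assms unfolding irreflp_def by auto
  have split: "(\<Sum>w\<in>V. f w) = f x + f y + (\<Sum>w\<in>V - {x, y}. f w)" for f :: "'a \<Rightarrow> nat"
  proof -
    have "(\<Sum>w\<in>V. f w) = f x + (\<Sum>w\<in>V - {x}. f w)" using assms by (simp add: sum.remove)
    also have "(\<Sum>w\<in>V - {x}. f w) = f y + (\<Sum>w\<in>V - {x} - {y}. f w)"
      using assms xy by (intro sum.remove) auto
    also have "V - {x} - {y} = V - {x, y}" by auto
    finally show ?thesis by simp
  qed
  have "(\<Sum>w\<in>V - {x, y}. (degree V (shift E x y) w)\<^sup>2) = (\<Sum>w\<in>V - {x, y}. (degree V E w)\<^sup>2)"
    using degree_shift_other[OF assms(1,2,4,5) _ _ xy] by (intro sum.cong) auto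
  then show ?thesis unfolding split degree_shift[OF assms]
    by (simp add: power2_eq_square algebra_simps)
qed

lemma potential_shift_to_anchor:
  assumes "short_pair q V E u v" "x \<in> V" "x \<noteq> v" "E u x"
    and "w \<in> V" "E x w" "w \<noteq> u" "\<not> E u w"
  shows "potential V E u v < potential V (shift E x u) u v"
proof -
  from assms(1) have fin: "finite V" and sym: "symp E" and irr: "irreflp E" and uv: "u \<in> V" "v \<in> V"
    unfolding short_pair_def by auto
  have "u \<noteq> v" by (rule short_pair_neq[OF assms(1)])
  have "u \<noteq> x" using assms irr unfolding irreflp_def by auto
  have "E x u" using assms(4) sym by (blast dest: sympD)
  have "card {w \<in> V. E x w \<and> w \<noteq> u \<and> \<not> E u w} > 0"
    using assms fin by (auto simp: card_gt_0_iff)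
  then show ?thesis
    unfolding potential_def sum_degree_squares_shift[OF fin sym irr assms(2) uv(1) \<open>E x u\<close>]
    using degree_shift(2,4)[OF fin sym irr assms(2) uv(1) \<open>E x u\<close>]
      degree_shift_other[OF fin sym assms(2) uv(1), of v] \<open>u \<noteq> v\<close> \<open>u \<noteq> x\<close> assms(3)
    by simp
qed

lemma potential_shift_inside:
  assumes "finite V" "symp E" "irreflp E" "x \<in> V" "y \<in> V" "E x y" "{x, y} \<inter> {u, v} = {}"
    and "a \<in> V" "E x a" "a \<noteq> y" "\<not> E y a"
    and "b \<in> V" "E y b" "b \<noteq> x" "\<not> E x b"
  shows "potential V E u v < potential V (shift E x y) u v"
proof -
  have "card {w \<in> V. E x w \<and> w \<noteq> y \<and> \<not> E y w} > 0" "card {w \<in> V. E y w \<and> w \<noteq> x \<and> \<not> E x w} > 0"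
    using assms by (auto simp: card_gt_0_iff)
  moreover have "x \<noteq> y" using assms unfolding irreflp_def by auto
  ultimately show ?thesis
    unfolding potential_def sum_degree_squares_shift[OF assms(1-6)]
    using degree_shift_other[OF assms(1,2,4,5), of u] degree_shift_other[OF assms(1,2,4,5), of v] assms(7)
    by auto
qed

lemma degree_le: "finite V \<Longrightarrow> degree V E x \<le> card V"
  unfolding degree_def by (intro card_mono) auto

lemma potential_le:
  assumes "finite V"
  shows "potential V E u v \<le> card V * (card V)\<^sup>2 + 2 * card V"
proof -
  have "(\<Sum>x\<in>V. (degree V E x)\<^sup>2) \<le> card V * (card V)\<^sup>2"
    using sum_bounded_above[of V "\<lambda>x. (degree V E x)\<^sup>2" "(card V)\<^sup>2"] degree_le[OF assms]
    by (simp add: power_mono)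
  then show ?thesis using degree_le[OF assms, of E u] degree_le[OF assms, of E v]
    unfolding potential_def by simp
qed

lemma potential_add_edge:
  assumes fin: "finite V" and "\<And>a b. E a b \<Longrightarrow> E' a b" and "x \<in> V" "y \<in> V" "\<not> E x y" "E' x y"
  shows "potential V E u v < potential V E' u v"
proof -
  have le: "degree V E w \<le> degree V E' w" for w
    unfolding degree_def using assms by (intro card_mono) auto
  have "degree V E x < degree V E' x"
    unfolding degree_def using assms by (intro psubset_card_mono) auto
  then have "(\<Sum>x\<in>V. (degree V E x)\<^sup>2) < (\<Sum>x\<in>V. (degree V E' x)\<^sup>2)"
    using le assms by (intro sum_strict_mono_ex1) (auto intro!: power_mono power_strict_mono bexI[of _ x])
  then show ?thesis using le[of u] le[of v] unfolding potential_def by simp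
qed

section \<open>The crossing argument\<close>

lemma successively_clique:
  "distinct xs \<Longrightarrow> clique E (set xs) \<Longrightarrow> successively E xs"
  by (induction xs rule: induct_list012) (auto simp: clique_def)

text \<open>
  Used with lists \<open>x # X\<close> and \<open>y # Y\<close>: two disjoint paths that an additional edge \<open>xy\<close> would join
  to a single one.
\<close>

definition path_pair :: "'a set \<Rightarrow> ('a \<Rightarrow> 'a \<Rightarrow> bool) \<Rightarrow> 'a list \<Rightarrow> 'a list \<Rightarrow> bool" where
  "path_pair H E X Y \<longleftrightarrow>
     distinct (X @ Y) \<and> set (X @ Y) \<subseteq> H \<and> successively E X \<and> successively E Y"

lemma path_pair_swap: "path_pair H E X Y \<Longrightarrow> path_pair H E Y X"
  unfolding path_pair_def by auto

text \<open>
  If \<open>A\<close> is a clique containing \<open>x\<close> and all its neighbours, then the successor of \<open>x\<close> lies in \<open>A\<close>, so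
  any further vertices of \<open>A\<close> fit between \<open>x\<close> and its successor.
\<close>

lemma path_pair_insert:
  assumes "path_pair H E (x # X) Y" "clique E A" "A \<subseteq> H" "x \<in> A"
    and nbhd: "\<And>w. w \<in> H \<Longrightarrow> E x w \<Longrightarrow> w \<in> A"
    and W: "distinct W" "set W \<subseteq> A" "set W \<inter> set (x # X @ Y) = {}"
  shows "path_pair H E (x # W @ X) Y"
proof (cases X)
  case Nil
  have "clique E (set (x # W))" by (rule clique_subset[OF assms(2)]) (use assms in auto)
  then have "successively E (x # W)" using W by (intro successively_clique) auto
  then show ?thesis using assms Nil unfolding path_pair_def by auto
next
  case (Cons x' X')
  have "x' \<in> A" using assms(1) Cons nbhd unfolding path_pair_def by auto
  then have "clique E (set (x # W @ [x']))" using assms by (intro clique_subset[OF assms(2)]) auto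
  moreover have "distinct (x # W @ [x'])" using assms(1) W Cons unfolding path_pair_def by auto
  ultimately have "successively E (x # W @ [x'])" by (intro successively_clique)
  then have "successively E (x # W @ X)"
    using assms(1) Cons unfolding path_pair_def
    by (auto simp: successively_append_iff successively_Cons hd_append split: if_splits)
  then show ?thesis using assms unfolding path_pair_def by auto
qed

lemma path_pair_cover:
  assumes "path_pair H E (x # X) (y # Y)" "finite H"
    and A: "clique E A" "A \<subseteq> H" "x \<in> A" "\<And>w. w \<in> H \<Longrightarrow> E x w \<Longrightarrow> w \<in> A"
    and B: "clique E B" "B \<subseteq> H" "y \<in> B" "\<And>w. w \<in> H \<Longrightarrow> E y w \<Longrightarrow> w \<in> B"
  shows "\<exists>X' Y'. path_pair H E (x # X') (y # Y') \<and> length X + length Y \<le> length X' + length Y'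
    \<and> A \<union> B \<subseteq> set (x # X' @ y # Y')"
proof -
  have fin: "finite (A - S)" "finite (B - S)" for S
    using finite_subset[OF A(2) assms(2)] finite_subset[OF B(2) assms(2)] by auto
  obtain W where W: "set W = A - set (x # X @ y # Y)" "distinct W"
    using finite_distinct_list[OF fin(1)] by blast
  have 1: "path_pair H E (x # W @ X) (y # Y)"
    by (rule path_pair_insert[OF assms(1) A]) (use W in auto)
  obtain W' where W': "set W' = B - set (x # (W @ X) @ y # Y)" "distinct W'"
    using finite_distinct_list[OF fin(2)] by blast
  have "path_pair H E (y # W' @ Y) (x # W @ X)"
    by (rule path_pair_insert[OF path_pair_swap[OF 1] B]) (use W' in auto)
  then have "path_pair H E (x # W @ X) (y # W' @ Y)" by (rule path_pair_swap)
  moreover have "A \<union> B \<subseteq> set (x # (W @ X) @ y # W' @ Y)" using W W' by auto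
  ultimately show ?thesis by (intro exI[of _ "W @ X"] exI[of _ "W' @ Y"]) simp
qed

text \<open>
  The last vertex \<open>z'\<close> of \<open>X\<close> outside \<open>A \<union> B\<close> is given up. The vertices behind it belong to \<open>A\<close> or to
  \<open>B\<close> and are put back next to \<open>x\<close> or \<open>y\<close>.
\<close>

lemma path_pair_drop:
  assumes "path_pair H E (x # X) (y # Y)"
    and A: "clique E A" "A \<subseteq> H" "x \<in> A" "\<And>w. w \<in> H \<Longrightarrow> E x w \<Longrightarrow> w \<in> A"
    and B: "clique E B" "B \<subseteq> H" "y \<in> B" "\<And>w. w \<in> H \<Longrightarrow> E y w \<Longrightarrow> w \<in> B"
    and cover: "A \<union> B \<subseteq> set (x # X @ y # Y)"
    and z: "z \<in> set X" "z \<notin> A \<union> B"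
  shows "\<exists>X' Y'. path_pair H E (x # X') (y # Y') \<and> Suc (length X' + length Y') = length X + length Y
    \<and> A \<union> B \<subseteq> set (x # X' @ y # Y')"
proof -
  obtain X1 z' W where X: "X = X1 @ z' # W" and z': "z' \<notin> A \<union> B" and W: "\<forall>w\<in>set W. \<not> w \<notin> A \<union> B"
    using split_list_last_propE[of X "\<lambda>z. z \<notin> A \<union> B"] z by blast
  define Wa Wb where "Wa = filter (\<lambda>w. w \<in> A) W" and "Wb = filter (\<lambda>w. w \<notin> A) W"
  have dist: "distinct ((x # X1) @ z' # W @ y # Y)" using assms(1) X unfolding path_pair_def by simp
  have 0: "path_pair H E (x # X1) (y # Y)"
    using assms(1) X unfolding path_pair_def by (auto simp: successively_append_iff successively_Cons split: if_splits)
  have 1: "path_pair H E (x # Wa @ X1) (y # Y)"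
    by (rule path_pair_insert[OF 0 A]) (use dist in \<open>auto simp: Wa_def\<close>)
  have "path_pair H E (y # Wb @ Y) (x # Wa @ X1)"
    by (rule path_pair_insert[OF path_pair_swap[OF 1] B]) (use dist W in \<open>auto simp: Wa_def Wb_def\<close>)
  then have "path_pair H E (x # Wa @ X1) (y # Wb @ Y)" by (rule path_pair_swap)
  moreover have "A \<union> B \<subseteq> set (x # (Wa @ X1) @ y # Wb @ Y)"
    using cover z' X W unfolding Wa_def Wb_def by auto
  moreover have "length Wa + length Wb = length W"
    unfolding Wa_def Wb_def by (rule sum_length_filter_compl)
  ultimately show ?thesis using X by (intro exI[of _ "Wa @ X1"] exI[of _ "Wb @ Y"]) simp
qed

lemma path_pair_trim:
  assumes "path_pair H E (x # X) (y # Y)"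
    and A: "clique E A" "A \<subseteq> H" "x \<in> A" "\<And>w. w \<in> H \<Longrightarrow> E x w \<Longrightarrow> w \<in> A"
    and B: "clique E B" "B \<subseteq> H" "y \<in> B" "\<And>w. w \<in> H \<Longrightarrow> E y w \<Longrightarrow> w \<in> B"
    and cover: "A \<union> B \<subseteq> set (x # X @ y # Y)"
    and n: "card (A \<union> B) \<le> n" "n \<le> length (x # X @ y # Y)"
  shows "\<exists>X' Y'. path_pair H E (x # X') (y # Y') \<and> length (x # X' @ y # Y') = n
    \<and> A \<union> B \<subseteq> set (x # X' @ y # Y')"
  using assms(1) cover n(2)
proof (induction "length X + length Y" arbitrary: X Y rule: less_induct)
  case less
  show ?case
  proof (cases "n = length (x # X @ y # Y)")
    case True then show ?thesis using less by blast
  next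
    case False
    have "card (set (x # X @ y # Y)) = length (x # X @ y # Y)"
      using less.prems(1) unfolding path_pair_def by (intro distinct_card) auto
    then have "A \<union> B \<noteq> set (x # X @ y # Y)" using n(1) less.prems(3) False by auto
    then obtain z where "z \<in> set X \<or> z \<in> set Y" "z \<notin> A \<union> B" using less.prems(2) A(3) B(3) by auto
    from this(1) have "\<exists>X' Y'. path_pair H E (x # X') (y # Y') \<and> Suc (length X' + length Y') = length X + length Y
      \<and> A \<union> B \<subseteq> set (x # X' @ y # Y')"
    proof
      assume "z \<in> set X"
      show ?thesis
        by (rule path_pair_drop[OF less.prems(1) A B less.prems(2) \<open>z \<in> set X\<close> \<open>z \<notin> A \<union> B\<close>]) auto
    next
      assume "z \<in> set Y"
      have "\<exists>Y' X'. path_pair H E (y # Y') (x # X') \<and> Suc (length Y' + length X') = length Y + length X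
        \<and> B \<union> A \<subseteq> set (y # Y' @ x # X')"
        by (rule path_pair_drop[OF path_pair_swap[OF less.prems(1)] B A _ \<open>z \<in> set Y\<close>])
           (use less.prems(2) \<open>z \<notin> A \<union> B\<close> in auto)
      then obtain Y' X' where "path_pair H E (y # Y') (x # X')"
        "Suc (length Y' + length X') = length Y + length X" "B \<union> A \<subseteq> set (y # Y' @ x # X')" by blast
      then show ?thesis using path_pair_swap by (intro exI[of _ X'] exI[of _ Y']) auto
    qed
    then obtain X' Y' where *: "path_pair H E (x # X') (y # Y')"
      "Suc (length X' + length Y') = length X + length Y" "A \<union> B \<subseteq> set (x # X' @ y # Y')" by blast
    show ?thesis using less.prems(3) False * by (intro less.hyps[OF _ *(1,3)]) auto
  qed
qed

text \<open>
  Ore's crossing argument. Together with \<open>u\<close>, which is adjacent to both far ends, the two paths form a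
  path \<open>Z\<close> from \<open>y\<close> to \<open>x\<close> on \<open>q + 2\<close> vertices. If \<open>x\<close> is adjacent to a vertex of \<open>Z\<close> and \<open>y\<close> to the next
  one, the vertices of \<open>Z\<close> lie on a cycle; opened at \<open>u\<close> and extended by \<open>v\<close>, it gives a path from
  \<open>u\<close> to \<open>v\<close> with too many interior vertices. Hence the neighbours of \<open>x\<close> on \<open>Z\<close> and the predecessors
  of the neighbours of \<open>y\<close> are disjoint sets among the first \<open>q + 1\<close> positions; \<open>u\<close> counts in both and
  makes up for \<open>x \<in> A\<close> and \<open>y \<in> B\<close>, which are not their own neighbours.
\<close>

lemma crossing_bound:
  assumes sym: "symp E" and irr: "irreflp E" and uv: "u \<in> V" "v \<in> V" "u \<noteq> v"
    and dom: "\<And>w. w \<in> V - {u, v} \<Longrightarrow> E w u \<and> E w v"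
    and short: "\<And>p. is_path V E u v p \<Longrightarrow> length p \<le> q + 2"
    and pair: "path_pair (V - {u, v}) E (x # X) (y # Y)" and len: "length (x # X @ y # Y) = q + 1"
    and A: "x \<in> A" "A \<subseteq> V - {u, v}" "\<And>w. w \<in> A - {x} \<Longrightarrow> E x w"
    and B: "y \<in> B" "B \<subseteq> V - {u, v}" "\<And>w. w \<in> B - {y} \<Longrightarrow> E y w"
    and cover: "A \<union> B \<subseteq> set (x # X @ y # Y)"
  shows "card A + card B \<le> q + 1"
proof -
  have com: "E a b \<longleftrightarrow> E b a" for a b using sym unfolding symp_def by auto
  define Z where "Z = (y # Y) @ u # rev (x # X)"
  have len_Z: "length Z = q + 2" using len unfolding Z_def by simp
  have dist: "distinct Z" using pair unfolding path_pair_def Z_def by auto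
  have set_Z: "set Z \<subseteq> insert u (V - {u, v})" "u \<in> set Z" "set (x # X @ y # Y) \<subseteq> set Z"
    using pair unfolding path_pair_def Z_def by auto
  have Z0: "Z ! 0 = y" unfolding Z_def by simp
  have Zq: "Z ! (q + 1) = x" "last Z = x"
    using len_Z last_conv_nth[of Z] unfolding Z_def by auto
  have suc: "successively E Z"
  proof -
    have in_H: "last (y # Y) \<in> V - {u, v}" "last (x # X) \<in> V - {u, v}"
      using pair last_in_set[of "y # Y"] last_in_set[of "x # X"] unfolding path_pair_def by auto
    have "successively E (rev (x # X))"
      using pair com unfolding path_pair_def successively_rev by (auto elim: successively_mono)
    moreover have "hd (rev (x # X)) = last (x # X)" by (simp only: hd_rev)
    ultimately show ?thesis using pair dom[OF in_H(1)] dom[OF in_H(2)] com[of u]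
      unfolding Z_def path_pair_def successively_append_iff successively_Cons[of E u] by auto
  qed
  have no_cross: "\<not> (E x (Z ! c) \<and> E y (Z ! Suc c))" if "c < q + 1" for c
  proof
    assume cross: "E x (Z ! c) \<and> E y (Z ! Suc c)"
    let ?T = "take (Suc c) Z" and ?D = "drop (Suc c) Z"
    have TD: "?T \<noteq> []" "?D \<noteq> []" "last ?T = Z ! c" "hd ?T = y" "hd ?D = Z ! Suc c" "last ?D = x"
    proof -
      have less: "Suc c < length Z" using that len_Z by simp
      then show "?T \<noteq> []" "?D \<noteq> []" by auto
      show "last ?T = Z ! c" using less by (simp add: take_Suc_conv_app_nth)
      show "hd ?T = y" using less Z0 by (cases Z) auto
      show "hd ?D = Z ! Suc c" using less by (rule hd_drop_conv_nth)
      show "last ?D = x" using less Zq(2) by simp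
    qed
    have "successively E (?T @ ?D)" using suc by simp
    then have sT: "successively E ?T" and sD: "successively E (rev ?D)"
      using com unfolding successively_append_iff by (auto elim: successively_mono)
    \<comment> \<open>The chords from \<open>x\<close> to \<open>Z ! c\<close> and from \<open>y\<close> to \<open>Z ! Suc c\<close> close this list to a cycle.\<close>
    define C where "C = ?T @ rev ?D"
    have C: "successively E C" "E (last C) (hd C)" "set C = set Z" "distinct C" "length C = q + 2"
    proof -
      show "successively E C" unfolding C_def successively_append_iff using sT sD TD cross com
        by (auto simp: hd_rev)
      show "E (last C) (hd C)" unfolding C_def using TD cross com by (simp add: last_rev)
      show "set C = set Z" unfolding C_def by (metis append_take_drop_id set_append set_rev)
      have "distinct (?T @ ?D)" using dist by simp
      then show "distinct C" unfolding C_def by (simp only: distinct_append distinct_rev set_rev)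
      show "length C = q + 2" unfolding C_def using len_Z that by simp
    qed
    \<comment> \<open>The cycle is rotated so that it starts at \<open>u\<close>.\<close>
    obtain C1 C2 where C12: "C = C1 @ u # C2" using C(3) set_Z(2) by (metis split_list)
    let ?p = "u # (C2 @ C1) @ [v]"
    have "successively E (u # C2 @ C1)"
      using C(1,2) unfolding C12 by (auto simp: successively_append_iff successively_Cons hd_append split: if_splits)
    moreover have "C2 @ C1 \<noteq> []" using C(5) len unfolding C12 by auto
    moreover have in_H: "set (C2 @ C1) \<subseteq> V - {u, v}" using C(3,4) set_Z(1) unfolding C12 by auto
    moreover have "E (last (C2 @ C1)) v"
      using dom[of "last (C2 @ C1)"] in_H last_in_set[OF \<open>C2 @ C1 \<noteq> []\<close>] by blast
    ultimately have "successively E ?p"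
      by (simp only: successively_append_iff successively_Cons) (auto simp: hd_append)
    then have "is_path V E u v ?p" using in_H uv C(4) unfolding is_path_def C12 by auto
    from short[OF this] show False using C(5) unfolding C12 by simp
  qed
  let ?I = "{c. c < q + 1 \<and> E x (Z ! c)}" and ?J = "{c. c < q + 1 \<and> E y (Z ! Suc c)}"
  have nth: "\<exists>c < q + 2. w = Z ! c" if "w \<in> set Z" for w
    using that len_Z by (metis in_set_conv_nth)
  have finA: "finite A" "finite B" using cover finite_subset[OF _ finite_set] by blast+
  have uH: "u \<notin> A" "u \<notin> B" using A(2) B(2) by auto
  have xyu: "E x u" "E y u" using dom A(1,2) B(1,2) by auto
  have "insert u (A - {x}) \<subseteq> (\<lambda>c. Z ! c) ` ?I"
  proof
    fix w assume w: "w \<in> insert u (A - {x})"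
    then have "w \<in> set Z" "w \<noteq> x" "E x w" using set_Z cover A uH xyu by auto
    moreover from nth[OF this(1)] obtain c where "c < q + 2" "w = Z ! c" by blast
    moreover have "c \<noteq> q + 1" using calculation Zq(1) by auto
    ultimately show "w \<in> (\<lambda>c. Z ! c) ` ?I" by auto
  qed
  then have "card (insert u (A - {x})) \<le> card ?I" by (rule surj_card_le[rotated]) simp
  moreover have "card (insert u (A - {x})) = card A"
    using A(1) uH finA card_Suc_Diff1[of A x] by simp
  moreover have "insert u (B - {y}) \<subseteq> (\<lambda>c. Z ! Suc c) ` ?J"
  proof
    fix w assume w: "w \<in> insert u (B - {y})"
    then have "w \<in> set Z" "w \<noteq> y" "E y w" using set_Z cover B uH xyu by auto
    moreover from nth[OF this(1)] obtain c where "c < q + 2" "w = Z ! c" by blast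
    moreover obtain c' where "c = Suc c'" using calculation Z0 by (cases c) auto
    ultimately show "w \<in> (\<lambda>c. Z ! Suc c) ` ?J" by auto
  qed
  then have "card (insert u (B - {y})) \<le> card ?J" by (rule surj_card_le[rotated]) simp
  moreover have "card (insert u (B - {y})) = card B"
    using B(1) uH finA card_Suc_Diff1[of B y] by simp
  moreover have "card ?I + card ?J = card (?I \<union> ?J)"
    using no_cross by (intro card_Un_disjoint[symmetric]) auto
  moreover have "card (?I \<union> ?J) \<le> card {..<q + 1}" by (intro card_mono) auto
  ultimately show ?thesis by simp
qed

section \<open>The extremal configuration\<close>

definition add_edge :: "('a \<Rightarrow> 'a \<Rightarrow> bool) \<Rightarrow> 'a \<Rightarrow> 'a \<Rightarrow> 'a \<Rightarrow> 'a \<Rightarrow> bool" where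
  "add_edge E x y a b \<longleftrightarrow> E a b \<or> (a = x \<and> b = y) \<or> (a = y \<and> b = x)"

definition closed_nbhd :: "'a set \<Rightarrow> ('a \<Rightarrow> 'a \<Rightarrow> bool) \<Rightarrow> 'a \<Rightarrow> 'a set" where
  "closed_nbhd V E w = insert w {z \<in> V. E w z}"

text \<open>
  A path that is too long must use the new edge; cutting it there and removing \<open>u\<close> and \<open>v\<close> leaves
  the two paths.
\<close>

lemma path_pair_of_add_edge:
  assumes sym: "symp E" and irr: "irreflp E" and xy: "x \<in> V - {u, v}" "y \<in> V - {u, v}"
    and "u \<noteq> v"
    and short: "\<And>p. is_path V E u v p \<Longrightarrow> length p \<le> q + 2"
    and p: "is_path V (add_edge E x y) u v p" "length p > q + 2"
  shows "\<exists>X Y. path_pair (V - {u, v}) E (x # X) (y # Y) \<and> q + 1 \<le> length (x # X @ y # Y)"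
proof -
  have com: "E a b \<longleftrightarrow> E b a" for a b using sym unfolding symp_def by auto
  have "\<not> is_path V E u v p" using short[of p] p(2) by auto
  then have "\<not> successively E p" using p(1) unfolding is_path_def by auto
  then obtain i where i: "Suc i < length p" "\<not> E (p ! i) (p ! Suc i)"
    unfolding successively_conv_nth by blast
  define a b where "a = p ! i" and "b = p ! Suc i"
  have p_split: "p = take i p @ a # b # drop (Suc (Suc i)) p"
    using i(1) unfolding a_def b_def by (simp add: Cons_nth_drop_Suc)
  have "add_edge E x y a b"
    using p(1) i(1) unfolding is_path_def a_def b_def successively_conv_nth by blast
  then have ab: "(a = x \<and> b = y) \<or> (a = y \<and> b = x)"
    using i(2) unfolding add_edge_def a_def b_def by blast
  define L1 L2 where "L1 = take i p" and "L2 = drop (Suc (Suc i)) p"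
  have p_eq: "p = L1 @ a # b # L2" using p_split unfolding L1_def L2_def .
  have "L1 \<noteq> []" "L2 \<noteq> []" using p(1) ab xy unfolding is_path_def p_eq by auto
  then obtain L1' L2' where L: "L1 = u # L1'" "L2 = L2' @ [v]"
    using p(1) unfolding is_path_def p_eq
    by (metis append_butlast_last_id hd_append2 last_ConsR last_append list.collapse list.distinct(1))
  have dist: "distinct (u # L1' @ a # b # L2' @ [v])" and V: "set p \<subseteq> V"
    and suc: "successively (add_edge E x y) (L1' @ [a])" "successively (add_edge E x y) (b # L2')"
    using p(1) unfolding is_path_def p_eq L
    by (auto simp: successively_append_iff successively_Cons split: if_splits)
  have drop_edge: "successively E C" if "successively (add_edge E x y) C" "\<not> (x \<in> set C \<and> y \<in> set C)" for C
    using that(1) by (rule successively_mono) (use that(2) in \<open>auto simp: add_edge_def\<close>)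
  have "successively E (L1' @ [a])" by (rule drop_edge[OF suc(1)]) (use ab dist in auto)
  then have "successively E (rev (L1' @ [a]))"
    using com unfolding successively_rev by (auto elim: successively_mono)
  moreover have "successively E (b # L2')" by (rule drop_edge[OF suc(2)]) (use ab dist in auto)
  ultimately have "path_pair (V - {u, v}) E (a # rev L1') (b # L2')"
    using dist V unfolding path_pair_def p_eq L by auto
  moreover have "q + 1 \<le> length (a # rev L1' @ b # L2')" using p(2) unfolding p_eq L by simp
  moreover have "path_pair (V - {u, v}) E (b # L2') (a # rev L1')"
    using calculation(1) by (rule path_pair_swap)
  moreover have "q + 1 \<le> length (b # L2' @ a # rev L1')" using p(2) unfolding p_eq L by simp
  ultimately show ?thesis using ab by blast
qed

text \<open>
  Take \<open>x\<close> in the clique with the smallest closed neighbourhood. By nestedness this neighbourhood is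
  contained in those of all other members, so each of its vertices could be added to the clique.
\<close>

lemma maximal_clique_eq_closed_nbhd:
  assumes "finite V" "symp E" "H \<subseteq> V"
    and nest: "\<And>x y. x \<in> H \<Longrightarrow> y \<in> H \<Longrightarrow> E x y
      \<Longrightarrow> closed_nbhd V E x \<subseteq> closed_nbhd V E y \<or> closed_nbhd V E y \<subseteq> closed_nbhd V E x"
    and K: "K \<subseteq> H" "clique E K" "K \<noteq> {}"
    and max: "\<And>w. w \<in> H \<Longrightarrow> clique E (insert w K) \<Longrightarrow> w \<in> K"
  shows "\<exists>x\<in>K. closed_nbhd V E x \<inter> H = K"
proof -
  have fin: "finite (closed_nbhd V E w)" for w unfolding closed_nbhd_def using assms(1) by auto
  obtain k where "k \<in> K" using K(3) by auto
  then obtain x where x: "x \<in> K" "\<And>z. z \<in> K \<Longrightarrow> card (closed_nbhd V E x) \<le> card (closed_nbhd V E z)"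
    using ex_has_least_nat[of "\<lambda>w. w \<in> K" k "\<lambda>w. card (closed_nbhd V E w)"] by auto
  have sub: "closed_nbhd V E x \<subseteq> closed_nbhd V E z" if "z \<in> K" for z
  proof (cases "z = x")
    case False
    then have "E x z" using K(2) x(1) that unfolding clique_def by auto
    then show ?thesis using nest[of x z] x that K(1) card_seteq[OF fin] by (metis order_refl subsetD)
  qed simp
  have "closed_nbhd V E x \<inter> H \<subseteq> K"
  proof
    fix w assume w: "w \<in> closed_nbhd V E x \<inter> H"
    have "w = z \<or> E z w" if "z \<in> K" for z using sub[OF that] w unfolding closed_nbhd_def by auto
    then have "clique E (insert w K)" using K(2) \<open>symp E\<close> unfolding clique_def symp_def by blast
    then show "w \<in> K" using w by (intro max) auto
  qed
  moreover have "K \<subseteq> closed_nbhd V E x \<inter> H"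
    using K x(1) assms(3) unfolding clique_def closed_nbhd_def by auto
  ultimately show ?thesis using x(1) by blast
qed

text \<open>
  The case to which everything is reduced: \<open>u\<close> and \<open>v\<close> dominate, \<open>H = V - {u, v}\<close> is connected with
  nested neighbourhoods and more than \<open>q\<close> vertices, and no edge can be added to \<open>H\<close>. Let \<open>B\<close> be a maximum clique of \<open>H\<close> and \<open>A\<close> a
  largest clique not contained in it. They are the closed neighbourhoods in \<open>H\<close> of nonadjacent
  vertices \<open>y\<close> and \<open>x\<close>, and the crossing argument gives \<open>card A + card B \<le> q + 1\<close>. The vertices of
  \<open>H - B\<close> are deleted in the order of increasing size of their closed neighbourhoods: when its turn comes, a vertex forms
  with its remaining neighbours in \<open>H\<close> a clique not contained in \<open>B\<close>, of order at most \<open>card A\<close>.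
\<close>

lemma few_cliques_extremal:
  assumes fin: "finite V" and sym: "symp E" and irr: "irreflp E" and uv: "u \<in> V" "v \<in> V" "u \<noteq> v"
    and dom: "\<And>w. w \<in> V - {u, v} \<Longrightarrow> E w u \<and> E w v"
    and short: "\<And>p. is_path V E u v p \<Longrightarrow> length p \<le> q + 2"
    and nest: "\<And>x y. x \<in> V - {u, v} \<Longrightarrow> y \<in> V - {u, v} \<Longrightarrow> E x y
      \<Longrightarrow> closed_nbhd V E x \<subseteq> closed_nbhd V E y \<or> closed_nbhd V E y \<subseteq> closed_nbhd V E x"
    and conn: "\<And>D. D \<noteq> {} \<Longrightarrow> D \<subset> V - {u, v} \<Longrightarrow> \<exists>d\<in>D. \<exists>w\<in>V - {u, v} - D. E d w"
    and sat: "\<And>x y. x \<in> V - {u, v} \<Longrightarrow> y \<in> V - {u, v} \<Longrightarrow> x \<noteq> y \<Longrightarrow> \<not> E x y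
      \<Longrightarrow> \<exists>p. is_path V (add_edge E x y) u v p \<and> length p > q + 2"
    and large: "q < card V - 2" and "s \<ge> 2"
  shows "few_cliques q s V E"
proof -
  define H where "H = V - {u, v}"
  note dom = dom[folded H_def] and nest = nest[folded H_def] and conn = conn[folded H_def]
    and sat = sat[folded H_def]
  have com: "E a b \<longleftrightarrow> E b a" for a b using sym unfolding symp_def by auto
  have finH: "finite H" and HV: "H \<subseteq> V" using fin unfolding H_def by auto
  have card_H: "card H = card V - 2" unfolding H_def using uv fin by (subst card_Diff_subset) auto
  have fin_nb: "finite (closed_nbhd V E w)" for w unfolding closed_nbhd_def using fin by auto
  have short_H: "length p \<le> q" if "distinct p" "set p \<subseteq> H" "successively E p" for p
  proof (cases "p = []")
    case False
    then have "hd p \<in> H" "last p \<in> H" using that(2) hd_in_set last_in_set by blast+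
    then have "successively E (u # p @ [v])"
      using that False dom[of "hd p"] dom[of "last p"] com[of u]
      by (auto simp: successively_append_iff successively_Cons hd_append)
    then have "is_path V E u v (u # p @ [v])" using that uv unfolding is_path_def H_def by auto
    then show ?thesis using short by fastforce
  qed simp
  \<comment> \<open>By nestedness and connectedness, a vertex with the largest closed neighbourhood dominates \<open>H\<close>.\<close>
  obtain w0 where w0: "w0 \<in> H" "H \<subseteq> closed_nbhd V E w0"
  proof -
    have nb_le: "card (closed_nbhd V E w) \<le> card V" if "w \<in> H" for w
      using that HV fin unfolding closed_nbhd_def by (intro card_mono) auto
    have "H \<noteq> {}" using large card_H by auto
    then obtain h where "h \<in> H" by auto
    then obtain w where w: "w \<in> H" "\<And>z. z \<in> H \<Longrightarrow> card (closed_nbhd V E z) \<le> card (closed_nbhd V E w)"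
      using ex_has_greatest_nat[of "\<lambda>w. w \<in> H" h "\<lambda>w. card (closed_nbhd V E w)" "Suc (card V)"] nb_le
      by (auto simp: less_Suc_eq_le)
    have "closed_nbhd V E w \<inter> H = H"
    proof (rule ccontr)
      assume "closed_nbhd V E w \<inter> H \<noteq> H"
      then have "closed_nbhd V E w \<inter> H \<subset> H" "closed_nbhd V E w \<inter> H \<noteq> {}"
        using w(1) unfolding closed_nbhd_def by auto
      then obtain d z where dz: "d \<in> closed_nbhd V E w \<inter> H" "z \<in> H" "z \<notin> closed_nbhd V E w" "E d z"
        using conn[of "closed_nbhd V E w \<inter> H"] by blast
      then have "d \<noteq> w" using HV unfolding closed_nbhd_def by auto
      then have "E w d" using dz unfolding closed_nbhd_def by auto
      moreover have "z \<in> closed_nbhd V E d" using dz HV unfolding closed_nbhd_def by auto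
      ultimately have "closed_nbhd V E w \<subseteq> closed_nbhd V E d" using nest[of w d] w(1) dz by auto
      then have "closed_nbhd V E w = closed_nbhd V E d" using w(2)[of d] dz card_seteq[OF fin_nb] by auto
      then show False using dz \<open>z \<in> closed_nbhd V E d\<close> by auto
    qed
    then show ?thesis using that w by blast
  qed
  have card_le_H: "K \<subseteq> H \<Longrightarrow> card K \<le> card H" for K using finH by (rule card_mono)
  obtain B where B: "B \<subseteq> H" "clique E B" and B_max: "\<And>K. K \<subseteq> H \<Longrightarrow> clique E K \<Longrightarrow> card K \<le> card B"
    using ex_has_greatest_nat[of "\<lambda>K. K \<subseteq> H \<and> clique E K" "{}" card "Suc (card H)"] card_le_H
    by (auto simp: clique_def less_Suc_eq_le)
  have finB: "finite B" using B finH finite_subset by auto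
  have "\<not> H \<subseteq> B"
  proof
    assume "H \<subseteq> B"
    then have "clique E H" using B by auto
    moreover obtain p where p: "set p = H" "distinct p" using finite_distinct_list[OF finH] by blast
    ultimately have "successively E p" by (intro successively_clique) auto
    then have "length p \<le> q" using short_H p by auto
    then show False using distinct_card[OF p(2)] p(1) card_H large by simp
  qed
  then obtain z0 where z0: "z0 \<in> H" "z0 \<notin> B" by auto
  let ?P = "\<lambda>K. K \<subseteq> H \<and> clique E K \<and> \<not> K \<subseteq> B"
  have "?P {z0}" using z0 unfolding clique_def by simp
  moreover have "\<forall>K. ?P K \<longrightarrow> card K < Suc (card H)" using card_le_H by (simp add: less_Suc_eq_le)
  ultimately have "\<exists>A. ?P A \<and> (\<forall>K. ?P K \<longrightarrow> card K \<le> card A)" by (rule ex_has_greatest_nat)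
  then obtain A where A_greatest: "?P A \<and> (\<forall>K. ?P K \<longrightarrow> card K \<le> card A)" ..
  then have A: "A \<subseteq> H" "clique E A" "\<not> A \<subseteq> B" by simp_all
  have A_max: "card K \<le> card A" if "K \<subseteq> H" "clique E K" "\<not> K \<subseteq> B" for K
    using A_greatest that by simp
  have finA: "finite A" using A finH finite_subset by auto
  have "B \<noteq> {}" using B_max[of "{z0}"] z0 by (auto simp: clique_def)
  have B_closed: "w \<in> B" if "w \<in> H" "clique E (insert w B)" for w
    using B_max[of "insert w B"] that B finB by (cases "w \<in> B") auto
  have A_closed: "w \<in> A" if "w \<in> H" "clique E (insert w A)" for w
    using A_max[of "insert w A"] that A finA by (cases "w \<in> A") auto
  obtain y where y: "y \<in> B" "closed_nbhd V E y \<inter> H = B"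
    using maximal_clique_eq_closed_nbhd[OF fin sym HV nest B \<open>B \<noteq> {}\<close> B_closed] by blast
  obtain x where x: "x \<in> A" "closed_nbhd V E x \<inter> H = A"
    using maximal_clique_eq_closed_nbhd[OF fin sym HV nest A(1,2) _ A_closed] A(3) by blast
  have clique_nbhd: "K \<subseteq> closed_nbhd V E z \<inter> H" if "clique E K" "z \<in> K" "K \<subseteq> H" for K z
    using that HV unfolding clique_def closed_nbhd_def by auto
  have AB_le: "card A \<le> card B" using B_max[OF A(1,2)] .
  have "x \<notin> B"
  proof
    assume "x \<in> B"
    then have "B \<subseteq> A" using clique_nbhd[OF B(2) _ B(1)] x(2) by auto
    then have "A = B" using card_seteq[OF finA _ AB_le] by auto
    then show False using A(3) by auto
  qed
  have "y \<noteq> x" "\<not> E x y" using y x \<open>x \<notin> B\<close> B(1) A(1) com[of x y] HV unfolding closed_nbhd_def by auto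
  then obtain p where p: "is_path V (add_edge E x y) u v p" "length p > q + 2"
    using sat[of x y] x(1) y(1) A(1) B(1) by blast
  have xyH: "x \<in> V - {u, v}" "y \<in> V - {u, v}" using x(1) y(1) A(1) B(1) unfolding H_def by auto
  obtain X Y where XY: "path_pair H E (x # X) (y # Y)" "q + 1 \<le> length (x # X @ y # Y)"
    using path_pair_of_add_edge[OF sym irr xyH uv(3) short p] unfolding H_def by blast
  have A_nb: "w \<in> A" if "w \<in> H" "E x w" for w using that x(2) HV unfolding closed_nbhd_def by auto
  have B_nb: "w \<in> B" if "w \<in> H" "E y w" for w using that y(2) HV unfolding closed_nbhd_def by auto
  obtain X1 Y1 where XY1: "path_pair H E (x # X1) (y # Y1)" "length X + length Y \<le> length X1 + length Y1"
      "A \<union> B \<subseteq> set (x # X1 @ y # Y1)"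
    using path_pair_cover[OF XY(1) finH A(2,1) x(1) A_nb B(2,1) y(1) B_nb] by blast
  \<comment> \<open>\<open>A \<union> B\<close> is traversed by a single path, because \<open>w0\<close> lies in both cliques.\<close>
  have "card (A \<union> B) \<le> q"
  proof -
    have "clique E (insert w0 K)" if "clique E K" "K \<subseteq> H" for K
      using that w0(2) com unfolding clique_def closed_nbhd_def by auto
    then have "w0 \<in> A \<inter> B" using A_closed B_closed A B w0(1) by auto
    obtain la lc lb where l: "set la = A - B" "distinct la" "set lc = A \<inter> B" "distinct lc" "set lb = B - A" "distinct lb"
      using finite_distinct_list[of "A - B"] finite_distinct_list[of "A \<inter> B"] finite_distinct_list[of "B - A"] finA finB
      by (metis finite_Diff finite_Int)
    have "successively E (la @ lc)" using l A(2) by (intro successively_clique) (auto intro: clique_subset)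
    moreover have "successively E (lc @ lb)" using l B(2) by (intro successively_clique) (auto intro: clique_subset)
    moreover have "lc \<noteq> []" using l(3) \<open>w0 \<in> A \<inter> B\<close> by auto
    ultimately have "successively E (la @ lc @ lb)" by (auto simp: successively_append_iff)
    moreover have d: "distinct (la @ lc @ lb)" using l by auto
    moreover have st: "set (la @ lc @ lb) = A \<union> B" using l by auto
    ultimately have "length (la @ lc @ lb) \<le> q" using A(1) B(1) by (intro short_H) auto
    then show ?thesis using distinct_card[OF d] st by simp
  qed
  then obtain X2 Y2 where XY2: "path_pair H E (x # X2) (y # Y2)" "length (x # X2 @ y # Y2) = q + 1"
      "A \<union> B \<subseteq> set (x # X2 @ y # Y2)"
    using path_pair_trim[OF XY1(1) A(2,1) x(1) A_nb B(2,1) y(1) B_nb XY1(3), of "q + 1"] XY XY1(2) by auto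
  have sum_le: "card A + card B \<le> q + 1"
    by (rule crossing_bound[OF sym irr uv dom[unfolded H_def] short XY2(1)[unfolded H_def] XY2(2) x(1) _ _ y(1) _ _ XY2(3)])
       (use A B x(1) y(1) in \<open>auto simp: H_def clique_def\<close>)
  define a b where "a = card A - 1" and "b = card B - 1"
  have ab: "card A = a + 1" "card B = b + 1"
    unfolding a_def b_def using card_Suc_Diff1[OF finA x(1)] card_Suc_Diff1[OF finB y(1)] by linarith+
  have "clique_count V E s \<le> (card (B \<union> {u, v}) choose s) + card (V - (B \<union> {u, v})) * ((a + 2) choose (s - 1))"
  proof (rule clique_count_degenerate[OF fin])
    fix W' assume W': "B \<union> {u, v} \<subset> W'" "W' \<subseteq> V"
    then obtain z1 where "z1 \<in> W' - (B \<union> {u, v})" by auto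
    then obtain z where z: "z \<in> W' - (B \<union> {u, v})"
        "\<And>w. w \<in> W' - (B \<union> {u, v}) \<Longrightarrow> card (closed_nbhd V E z) \<le> card (closed_nbhd V E w)"
      using ex_has_least_nat[of "\<lambda>w. w \<in> W' - (B \<union> {u, v})" z1 "\<lambda>w. card (closed_nbhd V E w)"] by auto
    have zH: "z \<in> H" using z W' unfolding H_def by auto
    define Q where "Q = {w \<in> W' \<inter> H. w = z \<or> E z w}"
    \<comment> \<open>A member \<open>w\<close> of \<open>B\<close> with a smaller neighbourhood would make \<open>z\<close> adjacent to all of \<open>B\<close>; for other \<open>w\<close> this is the choice of \<open>z\<close>.\<close>
    have sub: "closed_nbhd V E z \<subseteq> closed_nbhd V E w" if "w \<in> Q" for w
    proof (rule ccontr)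
      assume no: "\<not> ?thesis"
      then have w: "w \<noteq> z" "w \<in> H" "w \<in> W'" "E z w" using that unfolding Q_def by auto
      then have le: "closed_nbhd V E w \<subseteq> closed_nbhd V E z" using nest[OF zH w(2,4)] no by auto
      show False
      proof (cases "w \<in> B")
        case True
        then have "B \<subseteq> closed_nbhd V E z" using clique_nbhd[OF B(2) True B(1)] le by auto
        then have "clique E (insert z B)" using B(2) z(1) com unfolding clique_def closed_nbhd_def by auto
        then show False using B_closed zH z(1) by auto
      next
        case False
        then have "card (closed_nbhd V E z) \<le> card (closed_nbhd V E w)" using z(2) w unfolding H_def by auto
        then show False using card_seteq[OF fin_nb le] no by auto
      qed
    qed
    have "clique E Q"
      unfolding clique_def
    proof (intro ballI impI)
      fix w w' assume w: "w \<in> Q" "w' \<in> Q" "w \<noteq> w'"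
      then have "w' \<in> closed_nbhd V E z" using HV unfolding Q_def closed_nbhd_def by auto
      then show "E w w'" using sub[OF w(1)] w(3) unfolding closed_nbhd_def by auto
    qed
    moreover have "z \<in> Q" using z zH unfolding Q_def by auto
    ultimately have "card Q \<le> card A" using z(1) by (intro A_max) (auto simp: Q_def)
    moreover have finQ: "finite Q" using finH unfolding Q_def by auto
    have "{w \<in> W' - {z}. E z w} \<subseteq> (Q - {z}) \<union> {u, v}" using W' unfolding Q_def H_def by auto
    then have "card {w \<in> W' - {z}. E z w} \<le> card ((Q - {z}) \<union> {u, v})" using finQ by (intro card_mono) auto
    moreover have "card ((Q - {z}) \<union> {u, v}) \<le> card (Q - {z}) + card {u, v}" by (rule card_Un_le)
    moreover have "card (Q - {z}) = card Q - 1" using \<open>z \<in> Q\<close> finQ by simp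
    moreover have "card {u, v} = 2" using uv(3) by simp
    ultimately have "card {w \<in> W' - {z}. E z w} \<le> a + 2" using ab(1) by linarith
    then show "\<exists>z\<in>W' - (B \<union> {u, v}). card {w \<in> W' - {z}. E z w} \<le> a + 2" using z(1) by blast
  qed (use B uv \<open>s \<ge> 2\<close> in \<open>auto simp: H_def\<close>)
  moreover have "card (B \<union> {u, v}) = b + 3"
    using B(1) finB uv ab(2) unfolding H_def by (subst card_Un_disjoint) auto
  moreover have "card (V - (B \<union> {u, v})) = (card V - 2) - 1 - b"
  proof -
    have "V - (B \<union> {u, v}) = H - B" unfolding H_def by auto
    then show ?thesis using card_Diff_subset[OF finB B(1)] ab(2) card_H by simp
  qed
  moreover have "(\<Sum>i<b + 1. layer s i) + (2 choose s) = (b + 3) choose s"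
    using sum_layer[of s "b + 1"] \<open>s \<ge> 2\<close> by (simp add: eval_nat_numeral)
  moreover have "(\<Sum>i<b + 1. layer s i) + ((card V - 2) - 1 - b) * layer s a \<le> balanced_sum q s (card V - 2)"
    using AB_le ab sum_le large \<open>s \<ge> 2\<close> by (intro balanced_sum_ge) auto
  ultimately show ?thesis unfolding few_cliques_def layer_def by simp
qed

section \<open>Reduction to the extremal configuration\<close>

lemma few_cliques_small:
  assumes "finite V" "2 \<le> card V" "card V - 2 \<le> q" "s \<ge> 2"
  shows "few_cliques q s V E"
proof -
  have "(\<Sum>i<card V - 2. layer s (i mod q)) = (\<Sum>i<card V - 2. layer s i)"
    using assms(3) by (intro sum.cong) auto
  then show ?thesis
    using clique_count_le_choose[OF assms(1), of E s] sum_layer[of s "card V - 2"] assms(2,4)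
      le_add_diff_inverse2[OF assms(2)]
    unfolding few_cliques_def balanced_sum_def by simp
qed

lemma few_cliques_shift:
  assumes "short_pair q V E u v" "x \<in> V" "y \<in> V" "E x y" "few_cliques q s V (shift E x y)"
  shows "few_cliques q s V E"
  using clique_count_shift[of V E x y s] assms unfolding short_pair_def few_cliques_def by auto

lemma potential_swap: "potential V E u v = potential V E v u"
  unfolding potential_def by simp

lemma short_pair_card:
  assumes "short_pair q V E u v"
  shows "2 \<le> card V"
proof -
  have "card {u, v} \<le> card V" using assms unfolding short_pair_def by (intro card_mono) auto
  then show ?thesis using short_pair_neq[OF assms] by simp
qed

lemma few_cliques_separation:
  fixes V :: "'a set"
  assumes pair: "short_pair q V E u v" and x: "x \<in> V" "E u x" and "q \<ge> 1"
    and D: "D \<noteq> {}" "D \<subseteq> V - {u, v, x}" "D \<union> {u, x} \<noteq> V"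
    and closed: "\<And>d w. d \<in> D \<Longrightarrow> w \<in> V - D - {u, x} \<Longrightarrow> \<not> E d w"
    and smaller: "\<And>(V' :: 'a set) u' v'. card V' < card V \<Longrightarrow> short_pair q V' E u' v' \<Longrightarrow> few_cliques q s V' E"
  shows "few_cliques q s V E"
proof -
  have fin: "finite V" and "u \<in> V" using pair unfolding short_pair_def by auto
  note parts = short_pair_separation[OF pair x D(1,2) closed]
  have "card (D \<union> {u, x}) < card V"
    using D x \<open>u \<in> V\<close> fin by (intro psubset_card_mono) auto
  moreover have "card (V - D) < card V" using D fin by (intro psubset_card_mono) auto
  ultimately show ?thesis
    using few_cliques_glue[OF pair x \<open>q \<ge> 1\<close> D(2) closed] smaller parts by blast
qed

text \<open>
  In a minimal counterexample a neighbour \<open>x \<noteq> v\<close> of \<open>u\<close> has no neighbour outside the closed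
  neighbourhood of \<open>u\<close>. Otherwise
  either \<open>{u, x}\<close> separates the graph, or \<open>x\<close> and \<open>u\<close> have no common neighbour and the edge is
  contracted, or the shift from \<open>x\<close> to \<open>u\<close> preserves 2-connectedness and increases the potential.
\<close>

lemma few_cliques_or_nested_nbhds:
  fixes V :: "'a set"
  assumes pair: "short_pair q V E u v" and "q \<ge> 1" "s \<ge> 2"
    and smaller: "\<And>(V' :: 'a set) E' u' v'. card V' < card V \<Longrightarrow> short_pair q V' E' u' v' \<Longrightarrow> few_cliques q s V' E'"
    and larger: "\<And>E'. short_pair q V E' u v \<Longrightarrow> potential V E u v < potential V E' u v
      \<Longrightarrow> few_cliques q s V E'"
    and "\<not> few_cliques q s V E"
    and x: "x \<in> V" "x \<noteq> v" "E u x" and w: "w \<in> V" "E x w" "w \<noteq> u"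
  shows "E u w"
proof (rule ccontr)
  assume "\<not> E u w"
  from pair have fin: "finite V" and sym: "symp E" and irr: "irreflp E" and uv: "u \<in> V" "v \<in> V"
    unfolding short_pair_def by auto
  have "u \<noteq> v" by (rule short_pair_neq[OF pair])
  have "u \<noteq> x" using x irr unfolding irreflp_def by auto
  have "E x u" using x(3) sym by (blast dest: sympD)
  have no_cut: "\<exists>d\<in>D. \<exists>w\<in>V - D - {u, x}. E d w" if D: "D \<noteq> {}" "D \<subseteq> V - {u, v, x}" for D
  proof (rule ccontr)
    assume "\<not> ?thesis"
    then have closed: "\<not> E d w" if "d \<in> D" "w \<in> V - D - {u, x}" for d w using that by blast
    have "D \<union> {u, x} \<noteq> V" using D uv x(2) \<open>u \<noteq> v\<close> by blast
    then have "few_cliques q s V E"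
      by (rule few_cliques_separation[OF pair x(1,3) \<open>q \<ge> 1\<close> D]) (use closed smaller in blast)+
    then show False using assms(6) by blast
  qed
  note removed = short_pair_shift_remove[OF pair x no_cut]
  show False
  proof (cases "\<exists>c\<in>V. E x c \<and> E u c")
    case False
    have "card (V - {x}) < card V" using x(1) fin by (intro psubset_card_mono) auto
    then have "few_cliques q s (V - {x}) (shift E x u)" using smaller removed by blast
    then show False using few_cliques_shift_remove[OF pair x \<open>s \<ge> 2\<close>] False assms(6) by blast
  next
    case True
    then obtain c where c: "c \<in> V" "E x c" "E u c" by blast
    then have "c \<noteq> x" "c \<noteq> u" using irr unfolding irreflp_def by auto
    have "anchored (V - {x}) (shift E x u) u v" using removed unfolding short_pair_def by blast
    then have "anchored V (shift E x u) u v"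
      by (rule anchored_add_vertex[of V x _ u v c])
         (use uv c \<open>c \<noteq> x\<close> \<open>c \<noteq> u\<close> \<open>E x u\<close> \<open>u \<noteq> x\<close> in \<open>auto simp: shift_def\<close>)
    then have "short_pair q V (shift E x u) u v"
      using x \<open>u \<noteq> x\<close> by (intro short_pair_shift[OF pair x(1) _ \<open>E x u\<close>]) auto
    moreover have "potential V E u v < potential V (shift E x u) u v"
      by (rule potential_shift_to_anchor[OF pair x w \<open>\<not> E u w\<close>])
    ultimately have "few_cliques q s V (shift E x u)" by (rule larger)
    then show False using few_cliques_shift[OF pair x(1) uv(1) \<open>E x u\<close>] assms(6) by blast
  qed
qed

text \<open>
  The closed neighbourhood of \<open>u\<close> is then a union of components of \<open>G - v\<close>, apart from \<open>v\<close>; as \<open>G - v\<close>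
  is connected, it contains all vertices.
\<close>

lemma dominating_if_nested_nbhds:
  assumes pair: "short_pair q V E u v"
    and nested: "\<And>x w. x \<in> V \<Longrightarrow> x \<noteq> v \<Longrightarrow> E u x \<Longrightarrow> w \<in> V \<Longrightarrow> E x w \<Longrightarrow> w \<noteq> u \<Longrightarrow> E u w"
    and w: "w \<in> V - {u, v}"
  shows "E w u"
proof (rule ccontr)
  assume "\<not> E w u"
  from pair have sym: "symp E" and uv: "u \<in> V" "v \<in> V" and anch: "anchored V E u v"
    unfolding short_pair_def by auto
  have com: "E a b \<longleftrightarrow> E b a" for a b using sym unfolding symp_def by auto
  define D where "D = {d \<in> V - {u, v}. \<not> E u d}"
  have "D \<noteq> {}" "D \<subseteq> V - {u, v, v}" using w \<open>\<not> E w u\<close> com unfolding D_def by auto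
  then obtain d z where dz: "d \<in> D" "z \<in> V" "z \<notin> D" "z \<noteq> v" "E d z"
    using anchoredD[OF anch uv(2)] by metis
  then have "z \<noteq> u" using com unfolding D_def by auto
  then have "E u z" using dz unfolding D_def by auto
  then have "E u d" using nested[of z d] dz com unfolding D_def by auto
  then show False using dz(1) unfolding D_def by auto
qed

text \<open>
  The induction step: a smallest counterexample with the largest potential would be of the extremal
  form, unless it has at most \<open>q + 2\<close> vertices, where the number of all \<open>s\<close>-sets is small enough.
  Once \<open>u\<close> and \<open>v\<close> dominate, 2-connectedness survives every shift and every added edge inside
  \<open>V - {u, v}\<close>.
\<close>

lemma few_cliques_step:
  fixes V :: "'a set"
  assumes pair: "short_pair q V E u v" and "q \<ge> 1" "s \<ge> 2"
    and smaller: "\<And>(V' :: 'a set) E' u' v'. card V' < card V \<Longrightarrow> short_pair q V' E' u' v' \<Longrightarrow> few_cliques q s V' E'"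
    and larger: "\<And>E'. short_pair q V E' u v \<Longrightarrow> potential V E u v < potential V E' u v
      \<Longrightarrow> few_cliques q s V E'"
  shows "few_cliques q s V E"
proof (rule ccontr)
  assume many: "\<not> few_cliques q s V E"
  from pair have fin: "finite V" and sym: "symp E" and irr: "irreflp E" and uv: "u \<in> V" "v \<in> V" "E u v"
    and short: "\<And>p. is_path V E u v p \<Longrightarrow> length p \<le> q + 2"
    unfolding short_pair_def by auto
  have "u \<noteq> v" by (rule short_pair_neq[OF pair])
  have com: "E a b \<longleftrightarrow> E b a" for a b using sym unfolding symp_def by auto
  \<comment> \<open>The hypotheses are symmetric in \<open>u\<close> and \<open>v\<close>, so the argument for \<open>u\<close> also applies to \<open>v\<close>.\<close>
  have larger': "few_cliques q s V E'"
    if "short_pair q V E' v u" "potential V E v u < potential V E' v u" for E'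
    using that larger[of E'] short_pair_swap[of q V E' v u]
    by (simp add: potential_swap[of V _ v u])
  have dom_u: "E w u" if "w \<in> V - {u, v}" for w
    by (rule dominating_if_nested_nbhds[OF pair _ that],
        rule few_cliques_or_nested_nbhds[OF pair assms(2,3) smaller larger many])
  have "E w v" if "w \<in> V - {v, u}" for w
    by (rule dominating_if_nested_nbhds[OF short_pair_swap[OF pair] _ that],
        rule few_cliques_or_nested_nbhds[OF short_pair_swap[OF pair] assms(2,3) smaller larger' many])
  with dom_u have dom: "E w u \<and> E w v" if "w \<in> V - {u, v}" for w using that by blast
  have nest: "closed_nbhd V E x \<subseteq> closed_nbhd V E y \<or> closed_nbhd V E y \<subseteq> closed_nbhd V E x"
    if x: "x \<in> V - {u, v}" and y: "y \<in> V - {u, v}" and "E x y" for x y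
  proof (rule ccontr)
    assume "\<not> ?thesis"
    then obtain a b where ab: "a \<in> closed_nbhd V E x" "a \<notin> closed_nbhd V E y"
      "b \<in> closed_nbhd V E y" "b \<notin> closed_nbhd V E x" by blast
    have "E y x" using \<open>E x y\<close> com by blast
    have "anchored V (shift E x y) u v"
    proof (rule anchored_dominating[OF uv(1,2) \<open>u \<noteq> v\<close>])
      fix w assume "w \<in> V - {u, v}"
      then show "shift E x y w u \<and> shift E x y w v"
        using dom[of w] dom[OF y] x y com unfolding shift_def by auto
    qed
    then have "short_pair q V (shift E x y) u v"
      using x \<open>E x y\<close> by (intro short_pair_shift[OF pair]) auto
    moreover have "potential V E u v < potential V (shift E x y) u v"
      by (rule potential_shift_inside[OF fin sym irr _ _ \<open>E x y\<close>, of _ _ a b])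
         (use x y ab \<open>E x y\<close> \<open>E y x\<close> in \<open>auto simp: closed_nbhd_def\<close>)
    ultimately have "few_cliques q s V (shift E x y)" by (rule larger)
    then show False using few_cliques_shift[OF pair _ _ \<open>E x y\<close>] x y many by blast
  qed
  have conn: "\<exists>d\<in>D. \<exists>w\<in>V - {u, v} - D. E d w" if D: "D \<noteq> {}" "D \<subset> V - {u, v}" for D
  proof (rule ccontr)
    assume "\<not> ?thesis"
    then have closed: "\<not> E d w" if "d \<in> D" "w \<in> V - D - {u, v}" for d w using that by blast
    have "D \<subseteq> V - {u, v, v}" "D \<union> {u, v} \<noteq> V" using D by auto
    then have "few_cliques q s V E"
      using closed smaller
      by (intro few_cliques_separation[OF pair uv(2,3) \<open>q \<ge> 1\<close> D(1)]) blast+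
    then show False using many by blast
  qed
  have sat: "\<exists>p. is_path V (add_edge E x y) u v p \<and> length p > q + 2"
    if xy: "x \<in> V - {u, v}" "y \<in> V - {u, v}" "x \<noteq> y" "\<not> E x y" for x y
  proof (rule ccontr)
    assume "\<not> ?thesis"
    then have "length p \<le> q + 2" if "is_path V (add_edge E x y) u v p" for p using that by (meson not_less)
    moreover have "symp (add_edge E x y)" using sym unfolding symp_def add_edge_def by blast
    moreover have "irreflp (add_edge E x y)" using irr xy(3) unfolding irreflp_def add_edge_def by blast
    moreover have "anchored V (add_edge E x y) u v"
      by (rule anchored_dominating[OF uv(1,2) \<open>u \<noteq> v\<close>]) (use dom in \<open>auto simp: add_edge_def\<close>)
    ultimately have "short_pair q V (add_edge E x y) u v"
      using fin uv unfolding short_pair_def by (auto simp: add_edge_def)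
    moreover have "potential V E u v < potential V (add_edge E x y) u v"
      by (rule potential_add_edge[OF fin, of _ _ x y]) (use xy in \<open>auto simp: add_edge_def\<close>)
    ultimately have "few_cliques q s V (add_edge E x y)" by (rule larger)
    moreover have "clique_count V E s \<le> clique_count V (add_edge E x y) s"
      by (rule clique_count_mono[OF fin]) (auto simp: add_edge_def)
    ultimately show False using many unfolding few_cliques_def by auto
  qed
  show False
  proof (cases "card V - 2 \<le> q")
    case True
    then show False using few_cliques_small[OF fin short_pair_card[OF pair]] \<open>s \<ge> 2\<close> many by blast
  next
    case False
    then have "few_cliques q s V E"
      using few_cliques_extremal[OF fin sym irr uv(1,2) \<open>u \<noteq> v\<close> dom short nest conn sat _ \<open>s \<ge> 2\<close>] by simp
    then show False using many by blast
  qed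
qed

theorem few_cliques_if_short_pair:
  fixes V :: "'a set"
  assumes "short_pair q V E u v" "q \<ge> 1" "s \<ge> 2"
  shows "few_cliques q s V E"
  using assms(1)
proof (induction "card V" arbitrary: V E u v rule: less_induct)
  case outer: less
  show ?case
    using outer.prems
  \<comment> \<open>The first two summands bound the potential.\<close>
  proof (induction "card V * (card V)\<^sup>2 + 2 * card V - potential V E u v" arbitrary: E rule: less_induct)
    case inner: less
    show ?case
    proof (rule few_cliques_step[OF inner.prems assms(2,3)])
      fix V' :: "'a set" and E' u' v' assume "card V' < card V" "short_pair q V' E' u' v'"
      then show "few_cliques q s V' E'" using outer.hyps by blast
    next
      fix E' assume E': "short_pair q V E' u v" "potential V E u v < potential V E' u v"
      have "finite V" using E'(1) unfolding short_pair_def by blast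
      then have "potential V E' u v \<le> card V * (card V)\<^sup>2 + 2 * card V" by (rule potential_le)
      then show "few_cliques q s V E'" using E' by (intro inner.hyps) auto
    qed
  qed
qed

section \<open>Two-connected graphs without long cycles through an edge\<close>

text \<open>
  A complete subgraph is determined by its vertex set.
\<close>

lemma num_cliques_le_clique_count:
  assumes "finite (pverts G)"
  shows "num_cliques s (with_proj G) \<le> clique_count (pverts G) (\<lambda>a b. (a, b) \<in> parcs G) s"
proof -
  let ?S = "{H. subgraph H (with_proj G) \<and> complete_digraph s H}"
  have ends: "tail H = fst" "head H = snd" if "H \<in> ?S" for H
    using that by (auto simp: subgraph_def compatible_def with_proj_def)
  have arcs: "arcs H = {(a, b). a \<in> verts H \<and> b \<in> verts H \<and> a \<noteq> b}" if "H \<in> ?S" for H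
  proof -
    have "arcs_ends H = arcs H" unfolding arcs_ends_def arc_to_ends_def using ends[OF that] by simp
    then show ?thesis using that unfolding complete_digraph_def by auto
  qed
  have "inj_on verts ?S"
    by (rule inj_onI) (auto intro!: pre_digraph.equality simp: arcs ends)
  moreover have "verts ` ?S \<subseteq> {K. K \<subseteq> pverts G \<and> card K = s \<and> clique (\<lambda>a b. (a, b) \<in> parcs G) K}"
  proof
    fix K assume "K \<in> verts ` ?S"
    then obtain H where H: "H \<in> ?S" "K = verts H" by blast
    have "arcs H \<subseteq> parcs G" "verts H \<subseteq> pverts G"
      using H(1) by (auto simp: subgraph_def with_proj_def)
    moreover have "card (verts H) = s" using H(1) unfolding complete_digraph_def by auto
    ultimately show "K \<in> {K. K \<subseteq> pverts G \<and> card K = s \<and> clique (\<lambda>a b. (a, b) \<in> parcs G) K}"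
      using arcs[OF H(1)] H(2) unfolding clique_def by auto
  qed
  ultimately show ?thesis
    unfolding num_cliques_def clique_count_def using assms by (intro card_inj_on_le) auto
qed

lemma awalk_of_path:
  assumes "successively (\<lambda>a b. (a, b) \<in> parcs G) p" "p \<noteq> []"
  shows "set (zip p (tl p)) \<subseteq> parcs G" "pcas (hd p) (zip p (tl p)) (last p)"
    "pawalk_verts (hd p) (zip p (tl p)) = p"
  using assms by (induction p rule: induct_list012) auto

text \<open>
  The arc from \<open>v\<close> back to \<open>u\<close> comes first, so that the walk starts at \<open>v\<close> and the vertices after the
  first are those of \<open>p\<close>; the cycle has as many arcs as \<open>p\<close> has vertices.
\<close>

lemma cycle_of_path:
  assumes path: "is_path (pverts G) (\<lambda>a b. (a, b) \<in> parcs G) u v p" and "(v, u) \<in> parcs G" "v \<in> pverts G"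
  shows "pre_digraph.cycle (with_proj G) ((v, u) # zip p (tl p))"
proof -
  have p: "p \<noteq> []" "hd p = u" "last p = v" "distinct p" "successively (\<lambda>a b. (a, b) \<in> parcs G) p"
    using path unfolding is_path_def by auto
  note walk = awalk_of_path[OF p(5,1)]
  have "pre_digraph.awalk (with_proj G) v ((v, u) # zip p (tl p)) v"
    unfolding pre_digraph.awalk_def using walk p assms by (simp add: cas_with_proj_eq)
  moreover have "distinct (tl (pre_digraph.awalk_verts (with_proj G) v ((v, u) # zip p (tl p))))"
    using walk p by (simp add: awalk_verts_with_proj_eq)
  ultimately show ?thesis unfolding pre_digraph.cycle_def by blast
qed

text \<open>
  A set \<open>D\<close> violating the condition would be closed under reachability in \<open>G - z\<close>, although \<open>u\<close> or \<open>v\<close>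
  is a vertex of \<open>G - z\<close> outside \<open>D\<close>.
\<close>

lemma anchored_of_2_connected:
  assumes "pair_graph G" "k_connected 2 (with_proj G)" "u \<in> pverts G" "v \<in> pverts G" "u \<noteq> v"
  shows "anchored (pverts G) (\<lambda>a b. (a, b) \<in> parcs G) u v"
  unfolding anchored_def
proof (intro ballI allI impI)
  fix z D assume z: "z \<in> pverts G" and D: "D \<noteq> {} \<and> D \<subseteq> pverts G - {u, v, z}"
  interpret pair_graph G by fact
  define H where "H = with_proj G \<restriction> (pverts G - {z})"
  show "\<exists>d\<in>D. \<exists>w\<in>pverts G - D - {z}. (d, w) \<in> parcs G"
  proof (rule ccontr)
    assume no: "\<not> ?thesis"
    have "connected H"
      using assms(2) z unfolding k_connected_def H_def by (elim conjE allE[of _ "{z}"]) simp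
    then have conn: "a \<rightarrow>\<^sup>*\<^bsub>mk_symmetric H\<^esub> b" if "a \<in> pverts G - {z}" "b \<in> pverts G - {z}" for a b
      using that unfolding connected_def strongly_connected_def H_def by simp
    obtain d t where dt: "d \<in> D" "t \<in> {u, v} - {z}" using D assms(5) by blast
    then have "d \<rightarrow>\<^sup>*\<^bsub>mk_symmetric H\<^esub> t" using D assms(3,4) by (intro conn) auto
    then have "t \<in> D"
      unfolding reachable_def
    proof (induction rule: rtrancl_on_induct)
      case (step a b)
      have "(a, b) \<in> parcs G \<or> (b, a) \<in> parcs G"
        using step(2) unfolding H_def by (auto simp: parcs_mk_symmetric)
      then have "(a, b) \<in> parcs G" using arcs_symmetric by blast
      then show "b \<in> D" using no step(4,5) D unfolding H_def by auto
    qed (use dt in simp)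
    then show False using dt D by auto
  qed
qed

theorem theorem1p5:
  fixes G :: "'a pair_pre_digraph" and n k s :: nat and u v :: 'a
  assumes "n \<ge> 3" and "k \<ge> 4" and "s \<ge> 2"
    and "pair_graph G" and "card (pverts G) = n" and "k_connected 2 (with_proj G)"
    and "(u, v) \<in> parcs G"
    and "\<not> (\<exists>p. pre_digraph.cycle (with_proj G) p \<and> length p \<ge> k \<and>
               ((u, v) \<in> set p \<or> (v, u) \<in> set p))"
  shows "num_cliques s (with_proj G) \<le> g_bound s n k"
proof -
  interpret pair_graph G by fact
  let ?E = "\<lambda>a b. (a, b) \<in> parcs G"
  have sym: "(a, b) \<in> parcs G \<Longrightarrow> (b, a) \<in> parcs G" for a b using arcs_symmetric by auto
  have irr: "a \<noteq> b" if "(a, b) \<in> parcs G" for a b using pair_no_loops[OF that] by simp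
  have uv: "u \<in> pverts G" "v \<in> pverts G"
    using arc_fst_in_verts[OF assms(7)] arc_snd_in_verts[OF assms(7)] by auto
  have "short_pair (k - 3) (pverts G) ?E u v"
    unfolding short_pair_def
  proof (intro conjI allI impI)
    show "anchored (pverts G) ?E u v"
      by (rule anchored_of_2_connected[OF assms(4,6) uv irr[OF assms(7)]])
    fix p assume p: "is_path (pverts G) ?E u v p"
    have "length ((v, u) # zip p (tl p)) = length p"
      using p unfolding is_path_def by (cases p) auto
    then have "length p < k"
      using cycle_of_path[OF p sym[OF assms(7)] uv(2)] assms(8) by (metis list.set_intros(1) not_less)
    then show "length p \<le> k - 3 + 2" using assms(2) by simp
  qed (use pair_finite_verts sym irr uv assms(7) in \<open>auto simp: symp_def irreflp_def\<close>)
  then have few: "clique_count (pverts G) ?E s \<le> balanced_sum (k - 3) s (n - 2) + (2 choose s)"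
    using few_cliques_if_short_pair[of "k - 3" "pverts G" ?E u v s] assms(2,3,5)
    unfolding few_cliques_def by simp
  define q r t where "q = k - 3" and "r = (n - 2) div q" and "t = (n - 2) mod q"
  have "q \<ge> 1" "q + 2 = k - 1" unfolding q_def using assms(2) by auto
  have "t < q" unfolding t_def using \<open>q \<ge> 1\<close> by simp
  have "n - 2 = r * q + t" unfolding r_def t_def by simp
  then have bal: "balanced_sum q s (n - 2) = r * (\<Sum>i<q. layer s i) + (\<Sum>i<t. layer s i)"
    unfolding balanced_sum_def using sum_mod_periods[of t q "layer s" r] \<open>t < q\<close> by simp
  have g: "g_bound s n k = (if s \<ge> 3 then r * ((q + 2) choose s) + ((t + 2) choose s)
      else r * (q choose 2) + (t choose 2) + 2 * (n - 2) + 1)"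
    unfolding g_bound_def Let_def \<open>q + 2 = k - 1\<close> by (simp only: q_def r_def t_def)
  have "balanced_sum q s (n - 2) + (2 choose s) = g_bound s n k"
  proof (cases "s \<ge> 3")
    case True
    then have "2 choose s = 0" by (intro binomial_eq_0) simp
    moreover have "(\<Sum>i<x. layer s i) = (x + 2) choose s" for x
      using sum_layer[of s x] True calculation by simp
    ultimately show ?thesis unfolding bal g using True by simp
  next
    case False
    then have "s = 2" using assms(3) by simp
    have "(\<Sum>i<x. layer 2 i) = (x choose 2) + 2 * x" for x
      by (induction x) (simp_all add: layer_def numeral_2_eq_2)
    then show ?thesis unfolding g[unfolded \<open>s = 2\<close>] \<open>s = 2\<close> bal[unfolded \<open>s = 2\<close>]
      using \<open>n - 2 = r * q + t\<close> by (simp add: algebra_simps)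
  qed
  then show ?thesis
    using few num_cliques_le_clique_count[OF pair_finite_verts, of s] unfolding q_def by linarith
qed

end
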